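(* Let $\Omega\subset\mathbb{R}^d$ be a non-empty, bounded, open set and let $\Phi\colon\mathbb{R}^N_+\to[0,\infty)$ satisfy (Φ.1), (Φ.2) and (Φ.3). Then there exists a $(1,\Phi)$-eigen-$N$-function of $\Omega$.
   Context: $BV_0(F)=\{u\in BV(\mathbb{R}^d): u=0 \text{ a.e. on } \mathbb{R}^d\setminus F\}$; $|Du|(\mathbb{R}^d)$ is the total variation. A $(1,N)$-function of $F$ is $u=(u_1,\dots,u_N)$ with $u_i\in BV_0(F)$, $u_i\ge0$, $\|u_i\|_{L^1}=1$, and $u_iu_j=0$ a.e. for $i\ne j$; set $[u]_1=(|Du_1|(\mathbb{R}^d),\dots,|Du_N|(\mathbb{R}^d))$. $\Lambda^{\Phi,N}_{1,1}(F)=\inf\{\Phi([u]_1): u \text{ a } (1,N)\text{-function of } F\}$; a minimizer is a $(1,\Phi)$-eigen-$N$-function of $F$. $\mathbb{R}^N_+=\{v:v_i\ge0\}$ with componentwise order. (Φ.1): $\Phi$ lower semicontinuous. (Φ.2): $\exists\delta>0$ with $\Phi(v)\ge\delta\sum_iv_i$. (Φ.3): $v\le w\Rightarrow\Phi(v)\le\Phi(w)$. *)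

theory Defs
  imports "HOL-Analysis.Analysis"
begin

definition divergence :: "('a::euclidean_space \<Rightarrow> 'a) \<Rightarrow> 'a \<Rightarrow> real" where
  "divergence \<phi> x = (\<Sum>b\<in>Basis. frechet_derivative \<phi> (at x) b \<bullet> b)"

definition test_field :: "('a::euclidean_space \<Rightarrow> 'a) \<Rightarrow> bool" where
  "test_field \<phi> \<longleftrightarrow>
     (\<forall>x. \<phi> differentiable (at x)) \<and>
     (\<forall>b\<in>Basis. continuous_on UNIV (\<lambda>x. frechet_derivative \<phi> (at x) b)) \<and>
     compact (closure {x. \<phi> x \<noteq> 0}) \<and>
     (\<forall>x. norm (\<phi> x) \<le> 1)"

definition total_variation :: "('a::euclidean_space \<Rightarrow> real) \<Rightarrow> ereal" where
  "total_variation u =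
     (SUP \<phi>\<in>{\<phi>. test_field \<phi>}. ereal (integral\<^sup>L lebesgue (\<lambda>x. u x * divergence \<phi> x)))"

definition BV :: "('a::euclidean_space \<Rightarrow> real) set" where
  "BV = {u. integrable lebesgue u \<and> total_variation u < \<infinity>}"

definition BV0 :: "'a::euclidean_space set \<Rightarrow> ('a \<Rightarrow> real) set" where
  "BV0 F = {u \<in> BV. AE x in lebesgue. x \<notin> F \<longrightarrow> u x = 0}"

(* (1,N)-functions; N = CARD('n) *)
definition one_N_function :: "'a::euclidean_space set \<Rightarrow> ('n::finite \<Rightarrow> 'a \<Rightarrow> real) \<Rightarrow> bool" where
  "one_N_function F u \<longleftrightarrow>
     (\<forall>i. u i \<in> BV0 F \<and> (AE x in lebesgue. u i x \<ge> 0)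
          \<and> integral\<^sup>L lebesgue (\<lambda>x. \<bar>u i x\<bar>) = 1) \<and>
     (\<forall>i j. i \<noteq> j \<longrightarrow> (AE x in lebesgue. u i x * u j x = 0))"

definition TV_vec :: "('n::finite \<Rightarrow> 'a::euclidean_space \<Rightarrow> real) \<Rightarrow> real^'n" where
  "TV_vec u = (\<chi> i. real_of_ereal (total_variation (u i)))"

definition Lambda_1_1 :: "(real^'n::finite \<Rightarrow> real) \<Rightarrow> 'a::euclidean_space set \<Rightarrow> real" where
  "Lambda_1_1 \<Phi> F = Inf {\<Phi> (TV_vec u) | u :: 'n \<Rightarrow> 'a \<Rightarrow> real. one_N_function F u}"

definition eigen_N_function :: "(real^'n::finite \<Rightarrow> real) \<Rightarrow> 'a::euclidean_space set \<Rightarrow> ('n \<Rightarrow> 'a \<Rightarrow> real) \<Rightarrow> bool" where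
  "eigen_N_function \<Phi> F u \<longleftrightarrow> one_N_function F u \<and> \<Phi> (TV_vec u) = Lambda_1_1 \<Phi> F"

definition nonneg_orthant :: "(real^'n::finite) set" where
  "nonneg_orthant = {v. \<forall>i. v $ i \<ge> 0}"

definition lsc_on :: "('b::topological_space) set \<Rightarrow> ('b \<Rightarrow> real) \<Rightarrow> bool" where
  "lsc_on S f \<longleftrightarrow> (\<forall>v\<in>S. \<forall>t < f v. eventually (\<lambda>y. t < f y) (at v within S))"

end

(*
  Direct method. By (Phi.2) a minimizing sequence has bounded total variations. A total variation
  bound M on u gives the translation estimate ||u(. + h) - u||_1 <= |h| M: for a C^1 function psi
  with compact support and a unit vector e, the function t |-> int u(x) psi(x + t e) dx has
  derivative int u div(psi(. + t e) e) <= M, and the L^1 norm is dual to such psi with |psi| <= 1.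
  Hence u is L^1-close to its averages over small balls, uniformly along the sequence. These averages
  are bounded and equi-Lipschitz, so a diagonal argument makes them converge pointwise along a
  subsequence, and by dominated convergence the subsequence is Cauchy in L^1 (all supports lie in the
  bounded set Omega). The constraints pass to the L^1 limit, and the total variation, being a
  supremum of L^1-continuous functionals, is lower semicontinuous; monotonicity and lower
  semicontinuity of Phi finish the proof. An admissible competitor is given by normalized cones
  over disjoint balls.
*)
theory Submission
  imports Defs "HOL-Complex_Analysis.Great_Picard"
begin

section \<open>Calculus of test functions: derivative bounds, shifts, difference quotients\<close>

section \<open>Compactly supported C1 functions\<close>

text \<open>The total variation is known only through its pairings with test fields, so no
  derivative of \<open>u\<close> is formed and no approximation of BV functions by smooth ones in
  variation is used: differences are moved onto the test function by substitution. The price is paid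
  on the dual side, where the sign of a difference of translates must be a bounded a.e. limit of
  compactly supported C1 functions. Since C1 suffices, polynomials times a C1 cutoff serve instead
  of mollifiers. Read backwards, the same trick turns a translation bound into a bound on all
  pairings, with a factor d; so a cone has finite variation without a Gauss-Green formula. Ball
  averages leak out of \<Omega>, but the members of the sequence vanish a.e. off \<Omega>, so
  averages need only be compared on \<Omega>, where constants are integrable. Variation may drop in
  the L1 limit, so the limit of the variation vectors only dominates the vector of the limit
  function: lower semicontinuity of \<Phi> acts at the former, monotonicity descends to the
  latter.\<close>

definition C1c :: "('a::euclidean_space \<Rightarrow> 'b::real_normed_vector) \<Rightarrow> bool" where
  "C1c \<phi> \<longleftrightarrow>
     (\<forall>x. \<phi> differentiable (at x)) \<and>
     (\<forall>b\<in>Basis. continuous_on UNIV (\<lambda>x. frechet_derivative \<phi> (at x) b)) \<and>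
     compact (closure {x. \<phi> x \<noteq> 0})"

text \<open>\<open>C1c\<close> leaves the codomain open so that vector fields and the scalar
  functions from which they are built share one theory.\<close>

lemma test_field_iff_C1c: "test_field \<phi> \<longleftrightarrow> C1c \<phi> \<and> (\<forall>x. norm (\<phi> x) \<le> 1)"
  by (auto simp: test_field_def C1c_def)

lemma C1c_has_derivative:
  assumes "C1c \<phi>"
  shows "(\<phi> has_derivative frechet_derivative \<phi> (at x)) (at x)"
  using assms unfolding C1c_def by (simp add: frechet_derivative_works)

text \<open>\<open>D\<close> is a candidate derivative; uniqueness identifies it with
  \<open>frechet_derivative\<close>, so continuity can be checked on an explicit formula. Any
  compact set outside which \<open>\<phi>\<close> vanishes may stand in for the support.\<close>

lemma C1cI:
  fixes \<phi> :: "'a::euclidean_space \<Rightarrow> 'b::real_normed_vector"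
  assumes "\<And>x. (\<phi> has_derivative D x) (at x)"
    and "\<And>b. b \<in> Basis \<Longrightarrow> continuous_on UNIV (\<lambda>x. D x b)"
    and "compact K" "\<And>x. x \<notin> K \<Longrightarrow> \<phi> x = 0"
  shows "C1c \<phi>" and "frechet_derivative \<phi> (at x) = D x"
proof -
  have D: "frechet_derivative \<phi> (at x) = D x" for x
    using frechet_derivative_at[OF assms(1)] by simp
  have "closure {x. \<phi> x \<noteq> 0} \<subseteq> K"
    using assms(3,4) by (intro closure_minimal compact_imp_closed) auto
  then have "compact (closure {x. \<phi> x \<noteq> 0})"
    using assms(3) by (metis closed_closure compact_Int_closed inf.absorb_iff2)
  then show "C1c \<phi>"
    using assms(1,2) D by (auto simp: C1c_def differentiable_def)
  show "frechet_derivative \<phi> (at x) = D x" by (fact D)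
qed

lemma C1c_frechet_derivative_linear:
  assumes "C1c \<phi>"
  shows "linear (frechet_derivative \<phi> (at x))"
  using C1c_has_derivative[OF assms] has_derivative_linear by blast

lemma linear_euclidean_expansion:
  fixes D :: "'a::euclidean_space \<Rightarrow> 'b::real_normed_vector"
  assumes "linear D"
  shows "D v = (\<Sum>b\<in>Basis. (v \<bullet> b) *\<^sub>R D b)"
proof -
  have "D v = D (\<Sum>b\<in>Basis. (v \<bullet> b) *\<^sub>R b)"
    by (simp only: euclidean_representation)
  also have "\<dots> = (\<Sum>b\<in>Basis. (v \<bullet> b) *\<^sub>R D b)"
    by (simp only: linear_sum[OF assms] linear_scale[OF assms])
  finally show ?thesis .
qed

lemma C1c_frechet_derivative_continuous:
  fixes \<phi> :: "'a::euclidean_space \<Rightarrow> 'b::real_normed_vector"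
  assumes "C1c \<phi>"
  shows "continuous_on UNIV (\<lambda>x. frechet_derivative \<phi> (at x) v)"
proof -
  have "frechet_derivative \<phi> (at x) v = (\<Sum>b\<in>Basis. (v \<bullet> b) *\<^sub>R frechet_derivative \<phi> (at x) b)" for x
    by (rule linear_euclidean_expansion[OF C1c_frechet_derivative_linear[OF assms]])
  moreover have "continuous_on UNIV (\<lambda>x. \<Sum>b\<in>Basis. (v \<bullet> b) *\<^sub>R frechet_derivative \<phi> (at x) b)"
    using assms unfolding C1c_def by (intro continuous_on_sum continuous_on_scaleR continuous_on_const) auto
  ultimately show ?thesis by (simp only:)
qed

text \<open>Off the support \<open>\<phi>\<close> is locally zero, hence so is its derivative; on
  the compact support each of the finitely many partial derivatives is bounded by
  continuity.\<close>

lemma C1c_frechet_derivative_bound: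
  fixes \<phi> :: "'a::euclidean_space \<Rightarrow> 'b::real_normed_vector"
  assumes "C1c \<phi>"
  obtains L where "L \<ge> 0" "\<And>x v. norm (frechet_derivative \<phi> (at x) v) \<le> L * norm v"
proof -
  let ?K = "closure {x. \<phi> x \<noteq> 0}"
  have zero: "frechet_derivative \<phi> (at x) b = 0" if "x \<notin> ?K" for x b
  proof -
    have "(\<phi> has_derivative (\<lambda>_. 0)) (at x)"
    proof (rule has_derivative_transform_within_open[of "\<lambda>_. 0"])
      show "open (- ?K)" "x \<in> - ?K" using that by auto
      show "0 = \<phi> y" if "y \<in> - ?K" for y
        using that closure_subset[of "{x. \<phi> x \<noteq> 0}"] by auto
    qed auto
    then show ?thesis using frechet_derivative_at by metis
  qed
  have "\<exists>B. \<forall>x. norm (frechet_derivative \<phi> (at x) b) \<le> B" for b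
  proof -
    have "compact ((\<lambda>x. frechet_derivative \<phi> (at x) b) ` ?K)"
      using C1c_frechet_derivative_continuous[OF assms, of b] assms
      by (intro compact_continuous_image) (auto simp: C1c_def intro: continuous_on_subset)
    then obtain B where "\<forall>x\<in>?K. norm (frechet_derivative \<phi> (at x) b) \<le> B"
      by (auto dest!: compact_imp_bounded simp: bounded_iff)
    \<comment> \<open>The maximum covers the zero values off the support; \<open>B\<close> itself
      may be negative if the support is empty.\<close>
    then have "norm (frechet_derivative \<phi> (at x) b) \<le> max B 0" for x
      using zero[of x b] by (cases "x \<in> ?K") (auto simp: le_max_iff_disj)
    then show ?thesis by blast
  qed
  then obtain B where B: "\<And>b x. norm (frechet_derivative \<phi> (at x) b) \<le> B b" by metis
  show ?thesis
  proof
    show "(\<Sum>b\<in>Basis. B b) \<ge> 0"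
      using order_trans[OF norm_ge_zero B] by (intro sum_nonneg) auto
    fix x v
    have "frechet_derivative \<phi> (at x) v = (\<Sum>b\<in>Basis. (v \<bullet> b) *\<^sub>R frechet_derivative \<phi> (at x) b)"
      by (rule linear_euclidean_expansion[OF C1c_frechet_derivative_linear[OF assms]])
    also have "norm \<dots> \<le> (\<Sum>b\<in>Basis. norm v * B b)"
    proof (rule sum_norm_le)
      fix b :: 'a assume "b \<in> Basis"
      then show "norm ((v \<bullet> b) *\<^sub>R frechet_derivative \<phi> (at x) b) \<le> norm v * B b"
        using B[of x b] Basis_le_norm[of b v] by (auto intro!: mult_mono)
    qed
    finally show "norm (frechet_derivative \<phi> (at x) v) \<le> (\<Sum>b\<in>Basis. B b) * norm v"
      by (simp add: sum_distrib_left mult.commute)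
  qed
qed

lemma C1c_lipschitz:
  fixes \<phi> :: "'a::euclidean_space \<Rightarrow> 'b::real_normed_vector"
  assumes "C1c \<phi>"
  obtains L where "L \<ge> 0" "\<And>x y. norm (\<phi> x - \<phi> y) \<le> L * norm (x - y)"
    "\<And>x v. norm (frechet_derivative \<phi> (at x) v) \<le> L * norm v"
proof -
  obtain L where L: "L \<ge> 0" "\<And>x v. norm (frechet_derivative \<phi> (at x) v) \<le> L * norm v"
    using C1c_frechet_derivative_bound[OF assms] by blast
  have "norm (\<phi> x - \<phi> y) \<le> L * norm (x - y)" for x y
  proof (rule differentiable_bound[of UNIV])
    show "(\<phi> has_derivative frechet_derivative \<phi> (at x)) (at x within UNIV)" for x
      using C1c_has_derivative[OF assms] by simp
    show "onorm (frechet_derivative \<phi> (at x)) \<le> L" for x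
      using L by (intro onorm_bound) auto
  qed auto
  with L that show ?thesis by blast
qed

lemma C1c_continuous:
  assumes "C1c \<phi>" shows "continuous_on UNIV \<phi>"
  by (simp add: continuous_on_eq_continuous_at has_derivative_continuous[OF C1c_has_derivative[OF assms]])

text \<open>The linear map \<open>T\<close> serves four purposes: the identity for plain shifts,
  division by a constant, the passage from a scalar \<open>\<psi>\<close> to the field
  \<open>\<psi> e\<close>, and the passage from a field to one of its components.\<close>

lemma C1c_compose_shift_linear:
  fixes \<phi> :: "'a::euclidean_space \<Rightarrow> 'b::real_normed_vector" and T :: "'b \<Rightarrow> 'c::real_normed_vector"
  assumes \<phi>: "C1c \<phi>" and T: "bounded_linear T"
  shows "C1c (\<lambda>x. T (\<phi> (x + a)))"
    and "frechet_derivative (\<lambda>x. T (\<phi> (x + a))) (at x) = (\<lambda>v. T (frechet_derivative \<phi> (at (x + a)) v))"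
proof -
  let ?K = "(\<lambda>x. x - a) ` closure {x. \<phi> x \<noteq> 0}"
  have 1: "((\<lambda>x. T (\<phi> (x + a))) has_derivative (\<lambda>v. T (frechet_derivative \<phi> (at (x + a)) v))) (at x)" for x
  proof (rule bounded_linear.has_derivative[OF T])
    have "((\<lambda>x. \<phi> (x + a)) has_derivative (\<lambda>v. frechet_derivative \<phi> (at (x + a)) (v + 0))) (at x)"
      by (rule has_derivative_compose[where f = "\<lambda>x. x + a",
            OF has_derivative_add[OF has_derivative_ident has_derivative_const] C1c_has_derivative[OF \<phi>]])
    then show "((\<lambda>x. \<phi> (x + a)) has_derivative (\<lambda>v. frechet_derivative \<phi> (at (x + a)) v)) (at x)"
      by simp
  qed
  have 2: "continuous_on UNIV (\<lambda>x. T (frechet_derivative \<phi> (at (x + a)) b))" for b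
    by (intro bounded_linear.continuous_on[OF T]
        continuous_on_compose2[OF C1c_frechet_derivative_continuous[OF \<phi>]] continuous_intros) auto
  have 3: "compact ?K"
    using \<phi> by (intro compact_continuous_image continuous_intros) (auto simp: C1c_def)
  have 4: "T (\<phi> (x + a)) = 0" if "x \<notin> ?K" for x
  proof -
    have "x + a \<notin> closure {x. \<phi> x \<noteq> 0}"
      using that by (metis add_diff_cancel_right' image_eqI)
    then have "\<phi> (x + a) = 0" using closure_subset[of "{x. \<phi> x \<noteq> 0}"] by auto
    then show ?thesis using T by (simp add: linear_0 bounded_linear.linear)
  qed
  show "C1c (\<lambda>x. T (\<phi> (x + a)))" by (rule C1cI(1)[OF 1 2 3 4])
  show "frechet_derivative (\<lambda>x. T (\<phi> (x + a))) (at x) = (\<lambda>v. T (frechet_derivative \<phi> (at (x + a)) v))"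
    by (rule C1cI(2)[OF 1 2 3 4])
qed

text \<open>\<open>u\<close> is only integrable, so the derivative falls on \<open>\<psi>\<close>. A
  Lipschitz constant \<open>L\<close> bounds all difference quotients by \<open>L * norm e\<close>,
  and dominated convergence applies along every null sequence.\<close>

lemma C1c_difference_quotient_integral:
  fixes \<psi> :: "'a::euclidean_space \<Rightarrow> real"
  assumes u: "integrable lborel u" and \<psi>: "C1c \<psi>"
  shows "((\<lambda>h. \<integral>x. u x * ((\<psi> (x + h *\<^sub>R e) - \<psi> x) / h) \<partial>lborel) \<longlongrightarrow>
      (\<integral>x. u x * frechet_derivative \<psi> (at x) e \<partial>lborel)) (at 0)"
  unfolding tendsto_at_iff_sequentially
proof (intro allI impI)
  fix X :: "nat \<Rightarrow> real" assume X: "\<forall>i. X i \<in> UNIV - {0}" and X0: "X \<longlonglongrightarrow> 0"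
  obtain L where L: "L \<ge> 0" "\<And>x y. norm (\<psi> x - \<psi> y) \<le> L * norm (x - y)"
    using C1c_lipschitz[OF \<psi>] by metis
  have [measurable]: "u \<in> borel_measurable borel" using u by (simp add: integrable_iff_bounded)
  have [measurable]: "\<psi> \<in> borel_measurable borel"
    using C1c_continuous[OF \<psi>] by (simp add: borel_measurable_continuous_onI)
  have [measurable]: "(\<lambda>x. frechet_derivative \<psi> (at x) e) \<in> borel_measurable borel"
    using C1c_frechet_derivative_continuous[OF \<psi>] by (simp add: borel_measurable_continuous_onI)
  have "(\<lambda>n. \<integral>x. u x * ((\<psi> (x + X n *\<^sub>R e) - \<psi> x) / X n) \<partial>lborel) \<longlonglongrightarrow>
      (\<integral>x. u x * frechet_derivative \<psi> (at x) e \<partial>lborel)"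
  proof (rule integral_dominated_convergence[where w = "\<lambda>x. \<bar>u x\<bar> * (L * norm e)"])
    show "integrable lborel (\<lambda>x. \<bar>u x\<bar> * (L * norm e))" using u by auto
    show "AE x in lborel. norm (u x * ((\<psi> (x + X n *\<^sub>R e) - \<psi> x) / X n)) \<le> \<bar>u x\<bar> * (L * norm e)" for n
    proof (rule AE_I2)
      fix x
      have "\<bar>\<psi> (x + X n *\<^sub>R e) - \<psi> x\<bar> \<le> L * norm e * \<bar>X n\<bar>"
        using L(2)[of "x + X n *\<^sub>R e" x] by (simp add: mult.commute mult.left_commute)
      then have "\<bar>(\<psi> (x + X n *\<^sub>R e) - \<psi> x) / X n\<bar> \<le> L * norm e"
        using X by (simp add: abs_divide divide_le_eq)
      then show "norm (u x * ((\<psi> (x + X n *\<^sub>R e) - \<psi> x) / X n)) \<le> \<bar>u x\<bar> * (L * norm e)"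
        unfolding real_norm_def abs_mult by (rule mult_left_mono) simp
    qed
    show "AE x in lborel. (\<lambda>n. u x * ((\<psi> (x + X n *\<^sub>R e) - \<psi> x) / X n)) \<longlonglongrightarrow> u x * frechet_derivative \<psi> (at x) e"
    proof (rule AE_I2, rule tendsto_mult_left)
      fix x
      note lin = C1c_frechet_derivative_linear[OF \<psi>, of x]
      have "((\<lambda>h::real. \<psi> (x + h *\<^sub>R e)) has_derivative (\<lambda>h. frechet_derivative \<psi> (at (x + 0 *\<^sub>R e)) (0 + h *\<^sub>R e))) (at 0)"
        by (rule has_derivative_compose[where f = "\<lambda>h. x + h *\<^sub>R e", OF _ C1c_has_derivative[OF \<psi>]])
          (auto intro!: derivative_eq_intros)
      then have "((\<lambda>h::real. \<psi> (x + h *\<^sub>R e)) has_real_derivative frechet_derivative \<psi> (at x) e) (at 0)"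
        by (simp add: has_field_derivative_def linear_scale[OF lin] mult_commute_abs)
      then have "((\<lambda>h. (\<psi> (x + h *\<^sub>R e) - \<psi> x) / h) \<longlongrightarrow> frechet_derivative \<psi> (at x) e) (at 0)"
        by (simp add: has_field_derivative_iff)
      then show "(\<lambda>n. (\<psi> (x + X n *\<^sub>R e) - \<psi> x) / X n) \<longlonglongrightarrow> frechet_derivative \<psi> (at x) e"
        using X X0 unfolding tendsto_at_iff_sequentially by (auto simp: comp_def)
    qed
  qed measurable
  then show "((\<lambda>h. \<integral>x. u x * ((\<psi> (x + h *\<^sub>R e) - \<psi> x) / h) \<partial>lborel) \<circ> X) \<longlonglongrightarrow>
      (\<integral>x. u x * frechet_derivative \<psi> (at x) e \<partial>lborel)"
    by (simp add: comp_def)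
qed

section \<open>Bounded measurable functions as a.e. limits of test functions\<close>

section \<open>Approximation by compactly supported C1 functions\<close>

lemma real_polynomial_function_C1:
  fixes p :: "'a::euclidean_space \<Rightarrow> real"
  assumes "real_polynomial_function p"
  shows "\<exists>D. \<forall>x. (p has_derivative D x) (at x) \<and> (\<forall>v. continuous_on UNIV (\<lambda>x. D x v))"
  using assms
proof (induction rule: real_polynomial_function.induct)
  case (linear f)
  then show ?case
    by (intro exI[of _ "\<lambda>x. f"]) (auto intro: bounded_linear_imp_has_derivative)
next
  case (const c)
  then show ?case by (intro exI[of _ "\<lambda>x v. 0"]) auto
next
  case (add f g)
  then obtain D E where "\<forall>x. (f has_derivative D x) (at x) \<and> (\<forall>v. continuous_on UNIV (\<lambda>x. D x v))"
    "\<forall>x. (g has_derivative E x) (at x) \<and> (\<forall>v. continuous_on UNIV (\<lambda>x. E x v))" by blast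
  then show ?case
    by (intro exI[of _ "\<lambda>x v. D x v + E x v"])
      (auto intro!: has_derivative_add continuous_on_add)
next
  case (mult f g)
  then obtain D E where DE: "\<forall>x. (f has_derivative D x) (at x) \<and> (\<forall>v. continuous_on UNIV (\<lambda>x. D x v))"
    "\<forall>x. (g has_derivative E x) (at x) \<and> (\<forall>v. continuous_on UNIV (\<lambda>x. E x v))" by blast
  then have "continuous_on UNIV f" "continuous_on UNIV g"
    by (meson continuous_at_imp_continuous_on has_derivative_continuous)+
  with DE show ?case
    by (intro exI[of _ "\<lambda>x v. f x * E x v + D x v * g x"])
      (auto intro!: has_derivative_mult continuous_on_add continuous_on_mult)
qed

text \<open>Squaring removes the kink of the positive part: at 0 the difference quotient is
  \<open>max 0 h\<close>, which tends to 0.\<close>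

lemma has_real_derivative_max_0_square:
  "((\<lambda>s::real. (max 0 s)\<^sup>2) has_real_derivative 2 * max 0 s) (at s)"
proof -
  consider "s < 0" | "s = 0" | "s > 0" by linarith
  then show ?thesis
  proof cases
    case 1
    have "((\<lambda>s. 0) has_real_derivative 0) (at s)" by simp
    then have "((\<lambda>s::real. (max 0 s)\<^sup>2) has_real_derivative 0) (at s)"
      by (rule has_field_derivative_transform_within_open[where S = "{..<0}"]) (use 1 in auto)
    then show ?thesis using 1 by simp
  next
    case 2
    have "((\<lambda>h::real. max 0 h) \<longlongrightarrow> 0) (at 0)"
      by (rule tendsto_eq_intros | simp)+
    moreover have "(max 0 h)\<^sup>2 / h = max 0 h" for h :: real
      by (auto simp: max_def power2_eq_square)
    ultimately show ?thesis using 2 by (simp add: has_field_derivative_iff)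
  next
    case 3
    have "((\<lambda>s. s\<^sup>2) has_real_derivative 2 * s) (at s)" by (auto intro!: derivative_eq_intros)
    then have "((\<lambda>s::real. (max 0 s)\<^sup>2) has_real_derivative 2 * s) (at s)"
      by (rule has_field_derivative_transform_within_open[where S = "{0<..}"]) (use 3 in auto)
    then show ?thesis using 3 by simp
  qed
qed

text \<open>The squared norm keeps the function differentiable at the origin; the outer square makes
  it C1 across the sphere of radius \<open>R\<close>. At fixed \<open>x\<close> it tends to 1 as
  \<open>R\<close> grows.\<close>

definition cutoff :: "real \<Rightarrow> 'a::euclidean_space \<Rightarrow> real" where
  "cutoff R x = (max 0 (1 - (x \<bullet> x) / R\<^sup>2))\<^sup>2"

lemma cutoff_bounds: "0 \<le> cutoff R x" "cutoff R x \<le> 1"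
  by (auto simp: cutoff_def intro!: power_le_one)

lemma cutoff_eq_0:
  assumes "R > 0" "norm x \<ge> R" shows "cutoff R x = 0"
proof -
  have "R\<^sup>2 \<le> x \<bullet> x" using assms by (simp add: dot_square_norm power_mono)
  then show ?thesis using assms by (simp add: cutoff_def max_def)
qed

lemma has_derivative_cutoff:
  "(cutoff R has_derivative (\<lambda>v. 2 * max 0 (1 - (x \<bullet> x) / R\<^sup>2) * (- (2 * (x \<bullet> v)) / R\<^sup>2))) (at x)"
proof -
  have "((\<lambda>x. 1 - (x \<bullet> x) / R\<^sup>2) has_derivative (\<lambda>v. - (2 * (x \<bullet> v)) / R\<^sup>2)) (at x)"
    unfolding divide_inverse
    by (auto intro!: derivative_eq_intros simp: inner_commute algebra_simps)
  from has_derivative_compose[OF this has_real_derivative_max_0_square[THEN has_field_derivative_imp_has_derivative]]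
  show ?thesis by (simp add: cutoff_def[abs_def])
qed

lemma C1c_cutoff_mult:
  fixes p :: "'a::euclidean_space \<Rightarrow> real"
  assumes p: "real_polynomial_function p" and R: "R > 0"
  shows "C1c (\<lambda>x. cutoff R x * p x)"
proof -
  obtain D where D: "\<And>x. (p has_derivative D x) (at x)" "\<And>v. continuous_on UNIV (\<lambda>x. D x v)"
    using real_polynomial_function_C1[OF p] by blast
  let ?E = "\<lambda>x v. 2 * max 0 (1 - (x \<bullet> x) / R\<^sup>2) * (- (2 * (x \<bullet> v)) / R\<^sup>2)"
  have cont: "continuous_on UNIV p" "continuous_on UNIV (cutoff R :: 'a \<Rightarrow> real)"
    using D(1) has_derivative_cutoff by (meson continuous_at_imp_continuous_on has_derivative_continuous)+
  show ?thesis
  proof (rule C1cI(1))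
    show "((\<lambda>x. cutoff R x * p x) has_derivative (\<lambda>v. cutoff R x * D x v + ?E x v * p x)) (at x)" for x
      by (rule has_derivative_mult[OF has_derivative_cutoff D(1)])
    show "continuous_on UNIV (\<lambda>x. cutoff R x * D x b + ?E x b * p x)" for b
      by (intro continuous_on_add continuous_on_mult cont D(2) continuous_intros) (use R in auto)
    show "compact (cball (0::'a) R)" by simp
    show "cutoff R x * p x = 0" if "x \<notin> cball 0 R" for x
      using that R by (auto intro: cutoff_eq_0)
  qed
qed

text \<open>Supplies the test functions that realize an L1 norm by duality. Lebesgue measurability
  gives continuous functions converging a.e.; clipping, Weierstrass approximation on growing balls
  and a cutoff turn them into C1 functions with compact support. The bound 1 has to survive, because
  both dominated convergence and membership in the class of test fields rely on it.\<close>

lemma C1c_approx_bounded_measurable: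
  fixes s :: "'a::euclidean_space \<Rightarrow> real"
  assumes s: "s \<in> borel_measurable lebesgue" and bound: "\<And>x. \<bar>s x\<bar> \<le> 1"
  obtains \<psi> where "\<And>n::nat. C1c (\<psi> n)" "\<And>n x. \<bar>\<psi> n x\<bar> \<le> 1"
    "AE x in lborel. (\<lambda>n. \<psi> n x) \<longlonglongrightarrow> s x"
proof -
  have "s measurable_on UNIV"
    using s by (intro lebesgue_measurable_imp_measurable_on) auto
  then obtain N g where N: "negligible N" and g: "\<And>n::nat. continuous_on UNIV (g n)"
    and lim: "\<And>x. x \<notin> N \<Longrightarrow> (\<lambda>n. g n x) \<longlonglongrightarrow> s x"
    by (auto simp: measurable_on_def)
  \<comment> \<open>Clipping enforces the bound 1 and leaves the limit unchanged, because
    \<open>s\<close> takes values in [-1, 1].\<close>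
  define c where "c = (\<lambda>n x. max (-1) (min 1 (g n x)))"
  have c: "continuous_on UNIV (c n)" for n
    unfolding c_def by (intro continuous_on_max continuous_on_min continuous_on_const g)
  have c1: "\<bar>c n x\<bar> \<le> 1" for n x by (auto simp: c_def)
  have "\<exists>p. real_polynomial_function p \<and> (\<forall>x\<in>cball 0 (real (Suc n)). \<bar>c n x - p x\<bar> < 1 / real (Suc n))" for n
    by (rule Stone_Weierstrass_real_polynomial_function[of "cball 0 (real (Suc n))" "c n" "1 / real (Suc n)"])
      (auto intro: continuous_on_subset[OF c])
  then obtain p where p: "\<And>n. real_polynomial_function (p n)"
    and pc: "\<And>n x. norm x \<le> real (Suc n) \<Longrightarrow> \<bar>c n x - p n x\<bar> < 1 / real (Suc n)"
    by (metis mem_cball_0)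
  \<comment> \<open>On the ball the polynomial exceeds 1 in absolute value by at most
    \<open>1 / real (Suc n)\<close>, and off the ball the cutoff is 0. The divisor restores the
    bound 1 and itself tends to 1.\<close>
  define \<psi> where "\<psi> = (\<lambda>n x. (cutoff (real (Suc n)) x * p n x) / (1 + 1 / real (Suc n)))"
  show ?thesis
  proof
    fix n
    have "C1c (\<lambda>x. cutoff (real (Suc n)) x * p n x)"
      using p by (intro C1c_cutoff_mult) auto
    from C1c_compose_shift_linear(1)[OF this, of "\<lambda>r. r / (1 + 1 / real (Suc n))" 0]
    show "C1c (\<psi> n)" unfolding \<psi>_def by (simp add: bounded_linear_divide)
    show "\<bar>\<psi> n x\<bar> \<le> 1" for x
    proof (cases "norm x \<le> real (Suc n)")
      case True
      have "\<bar>p n x\<bar> \<le> 1 + 1 / real (Suc n)" using pc[OF True] c1[of n x] by linarith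
      then have "cutoff (real (Suc n)) x * \<bar>p n x\<bar> \<le> 1 * (1 + 1 / real (Suc n))"
        by (intro mult_mono cutoff_bounds) auto
      moreover have pos: "0 < 1 + 1 / real (Suc n)" by (simp add: add_pos_nonneg)
      ultimately show ?thesis
        unfolding \<psi>_def abs_divide abs_mult abs_of_pos[OF pos] abs_of_nonneg[OF cutoff_bounds(1)]
        by (subst divide_le_eq_1_pos) simp_all
    next
      case False
      then show ?thesis by (simp add: \<psi>_def cutoff_eq_0)
    qed
  next
    have "N \<in> null_sets lebesgue" using N by (simp add: negligible_iff_null_sets)
    then have "AE x in lebesgue. x \<notin> N" by (rule AE_not_in)
    then have "AE x in lborel. x \<notin> N" by (simp add: AE_completion_iff)
    then show "AE x in lborel. (\<lambda>n. \<psi> n x) \<longlonglongrightarrow> s x"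
    proof eventually_elim
      fix x assume "x \<notin> N"
      have "(\<lambda>n. c n x) \<longlonglongrightarrow> max (-1) (min 1 (s x))"
        unfolding c_def by (intro tendsto_max tendsto_min tendsto_const lim) fact
      moreover have "max (-1) (min 1 (s x)) = s x" using bound[of x] by linarith
      ultimately have cs: "(\<lambda>n. c n x) \<longlonglongrightarrow> s x" by simp
      have inv: "(\<lambda>n. 1 / real (Suc n)) \<longlonglongrightarrow> 0"
        using LIMSEQ_inverse_real_of_nat by (simp add: inverse_eq_divide)
      have "(\<lambda>n. c n x - p n x) \<longlonglongrightarrow> 0"
      proof (rule Lim_null_comparison[OF _ inv])
        \<comment> \<open>Each \<open>x\<close> lies in all but finitely many of the approximation
          balls.\<close>
        have "eventually (\<lambda>n. norm x \<le> real n) sequentially"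
          using filterlim_real_sequentially by (simp add: filterlim_at_top)
        then show "eventually (\<lambda>n. norm (c n x - p n x) \<le> 1 / real (Suc n)) sequentially"
        proof eventually_elim
          fix n assume "norm x \<le> real n"
          then show "norm (c n x - p n x) \<le> 1 / real (Suc n)" using pc[of x n] by simp
        qed
      qed
      from tendsto_diff[OF cs this] have ps: "(\<lambda>n. p n x) \<longlonglongrightarrow> s x" by simp
      have "(\<lambda>n. (x \<bullet> x) * (1 / real (Suc n) * (1 / real (Suc n)))) \<longlonglongrightarrow> (x \<bullet> x) * (0 * 0)"
        by (intro tendsto_mult tendsto_const inv)
      then have "(\<lambda>n. (x \<bullet> x) / (real (Suc n))\<^sup>2) \<longlonglongrightarrow> 0"
        by (simp add: power2_eq_square)
      then have "(\<lambda>n. cutoff (real (Suc n)) x) \<longlonglongrightarrow> (max 0 (1 - 0))\<^sup>2"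
        unfolding cutoff_def by (intro tendsto_power tendsto_max tendsto_diff tendsto_const)
      then have "(\<lambda>n. \<psi> n x) \<longlonglongrightarrow> ((max 0 (1 - 0))\<^sup>2 * s x) / (1 + 0)"
        unfolding \<psi>_def by (intro tendsto_divide tendsto_mult tendsto_add tendsto_const inv ps) auto
      then show "(\<lambda>n. \<psi> n x) \<longlonglongrightarrow> s x" by simp
    qed
  qed
qed

section \<open>The L1 modulus of continuity of a function of bounded variation\<close>

section \<open>Translations in L1\<close>

text \<open>The extremal multiplier \<open>sgn (f x)\<close> is not C1, but its approximants satisfy
  the hypothesis, and \<open>\<bar>f x\<bar>\<close> dominates the products.\<close>

lemma L1_norm_le_by_duality:
  fixes f :: "'a::euclidean_space \<Rightarrow> real"
  assumes f: "integrable lborel f"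
    and M: "\<And>\<psi>. C1c \<psi> \<Longrightarrow> (\<And>x. \<bar>\<psi> x\<bar> \<le> 1) \<Longrightarrow> (\<integral>x. f x * \<psi> x \<partial>lborel) \<le> M"
  shows "(\<integral>x. \<bar>f x\<bar> \<partial>lborel) \<le> M"
proof -
  have [measurable]: "f \<in> borel_measurable borel" using f by (simp add: integrable_iff_bounded)
  have sgn_meas: "(\<lambda>x. sgn (f x)) \<in> borel_measurable lborel" by measurable
  obtain \<psi> where \<psi>: "\<And>n::nat. C1c (\<psi> n)" "\<And>n x. \<bar>\<psi> n x\<bar> \<le> 1"
    "AE x in lborel. (\<lambda>n. \<psi> n x) \<longlonglongrightarrow> sgn (f x)"
    by (rule C1c_approx_bounded_measurable[OF measurable_completion[OF sgn_meas]])
      (auto simp: sgn_if)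
  have [measurable]: "\<psi> n \<in> borel_measurable borel" for n
    using C1c_continuous[OF \<psi>(1)] by (simp add: borel_measurable_continuous_onI)
  have "(\<lambda>n. \<integral>x. f x * \<psi> n x \<partial>lborel) \<longlonglongrightarrow> (\<integral>x. f x * sgn (f x) \<partial>lborel)"
  proof (rule integral_dominated_convergence[where w = "\<lambda>x. \<bar>f x\<bar>"])
    show "AE x in lborel. (\<lambda>n. f x * \<psi> n x) \<longlonglongrightarrow> f x * sgn (f x)"
      using \<psi>(3) by eventually_elim (intro tendsto_mult_left)
    show "AE x in lborel. norm (f x * \<psi> n x) \<le> \<bar>f x\<bar>" for n
      using \<psi>(2)[of n] by (auto simp: abs_mult intro!: mult_left_le)
  qed (use f in auto)
  then have "(\<integral>x. f x * sgn (f x) \<partial>lborel) \<le> M"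
    by (rule LIMSEQ_le_const2) (use M \<psi> in auto)
  then show ?thesis by (simp add: abs_sgn)
qed

lemma integral_lborel_translate:
  fixes f :: "'a::euclidean_space \<Rightarrow> 'b::{banach, second_countable_topology}"
  assumes "f \<in> borel_measurable borel"
  shows "(\<integral>x. f (x + a) \<partial>lborel) = (\<integral>x. f x \<partial>lborel)"
    and "integrable lborel (\<lambda>x. f (x + a)) \<longleftrightarrow> integrable lborel f"
proof -
  have "(\<integral>x. f x \<partial>distr lborel borel ((+) a)) = (\<integral>x. f (a + x) \<partial>lborel)"
    by (rule integral_distr) (use assms in auto)
  then show "(\<integral>x. f (x + a) \<partial>lborel) = (\<integral>x. f x \<partial>lborel)"
    by (simp add: lborel_distr_plus add.commute)
  have "integrable (distr lborel borel ((+) a)) f \<longleftrightarrow> integrable lborel (\<lambda>x. f (a + x))"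
    by (rule integrable_distr_eq) (use assms in auto)
  then show "integrable lborel (\<lambda>x. f (x + a)) \<longleftrightarrow> integrable lborel f"
    by (simp add: lborel_distr_plus add.commute)
qed

lemma integrable_mult_bounded:
  fixes u f :: "'a \<Rightarrow> real"
  assumes "integrable M u" "f \<in> borel_measurable M" "\<And>x. \<bar>f x\<bar> \<le> B"
  shows "integrable M (\<lambda>x. u x * f x)"
proof (rule Bochner_Integration.integrable_bound)
  show "integrable M (\<lambda>x. B * \<bar>u x\<bar>)" using assms by auto
  show "AE x in M. norm (u x * f x) \<le> norm (B * \<bar>u x\<bar>)"
  proof (rule AE_I2)
    fix x
    have "\<bar>u x\<bar> * \<bar>f x\<bar> \<le> \<bar>u x\<bar> * B" using assms(3) by (intro mult_left_mono) auto
    also have "\<dots> \<le> norm (B * \<bar>u x\<bar>)" by (simp add: mult.commute)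
    finally show "norm (u x * f x) \<le> norm (B * \<bar>u x\<bar>)" by (simp add: abs_mult)
  qed
qed (use assms in \<open>auto intro!: borel_measurable_times\<close>)

lemma divergence_scaleR_const:
  fixes \<psi> :: "'a::euclidean_space \<Rightarrow> real"
  assumes "C1c \<psi>"
  shows "divergence (\<lambda>x. \<psi> x *\<^sub>R e) x = frechet_derivative \<psi> (at x) e"
proof -
  have "frechet_derivative (\<lambda>x. \<psi> x *\<^sub>R e) (at x) = (\<lambda>v. frechet_derivative \<psi> (at x) v *\<^sub>R e)"
    using C1c_compose_shift_linear(2)[OF assms bounded_linear_scaleR_left[of e], of 0] by simp
  then show ?thesis
    using linear_euclidean_expansion[OF C1c_frechet_derivative_linear[OF assms], of x e]
    by (simp add: divergence_def mult.commute)
qed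

text \<open>Mean value theorem in the length of the shift; since \<open>e\<close> is a unit vector,
  each shifted \<open>\<psi>\<close> times \<open>e\<close> is an admissible test field. A one-sided
  bound is enough, because the duality step takes a supremum over all \<open>\<psi>\<close>.\<close>

lemma translated_pairing_le:
  fixes u \<psi> :: "'a::euclidean_space \<Rightarrow> real"
  assumes u: "integrable lborel u"
    and tv: "\<And>\<phi>. test_field \<phi> \<Longrightarrow> (\<integral>x. u x * divergence \<phi> x \<partial>lborel) \<le> M"
    and \<psi>: "C1c \<psi>" "\<And>x. \<bar>\<psi> x\<bar> \<le> 1"
  shows "(\<integral>x. u x * \<psi> (x + h) \<partial>lborel) - (\<integral>x. u x * \<psi> x \<partial>lborel) \<le> norm h * M"
proof (cases "h = 0")
  case False
  define e where "e = h /\<^sub>R norm h"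
  have e: "norm e = 1" "norm h *\<^sub>R e = h" using False by (auto simp: e_def)
  define g where "g = (\<lambda>t. \<integral>x. u x * \<psi> (x + t *\<^sub>R e) \<partial>lborel)"
  define g' where "g' = (\<lambda>t. \<integral>x. u x * frechet_derivative (\<lambda>x. \<psi> (x + t *\<^sub>R e)) (at x) e \<partial>lborel)"
  have C: "C1c (\<lambda>x. \<psi> (x + a))" for a
    using C1c_compose_shift_linear(1)[OF \<psi>(1), of "\<lambda>r. r" a] by simp
  have int: "integrable lborel (\<lambda>x. u x * \<psi> (x + a))" for a
    by (rule integrable_mult_bounded[OF u]) 
      (use C1c_continuous[OF C] \<psi>(2) in \<open>auto simp: borel_measurable_continuous_onI\<close>)
  have "(g has_real_derivative g' t) (at t)" for t
  proof -
    have "((\<lambda>k. \<integral>x. u x * ((\<psi> ((x + k *\<^sub>R e) + t *\<^sub>R e) - \<psi> (x + t *\<^sub>R e)) / k) \<partial>lborel) \<longlongrightarrow> g' t) (at 0)"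
      unfolding g'_def by (rule C1c_difference_quotient_integral[OF u C])
    moreover have "(\<integral>x. u x * ((\<psi> ((x + k *\<^sub>R e) + t *\<^sub>R e) - \<psi> (x + t *\<^sub>R e)) / k) \<partial>lborel) = (g (t + k) - g t) / k" for k
    proof -
      have "(g (t + k) - g t) / k = (\<integral>x. (u x * \<psi> (x + (t + k) *\<^sub>R e) - u x * \<psi> (x + t *\<^sub>R e)) / k \<partial>lborel)"
        unfolding g_def by (simp add: int)
      then show ?thesis
        by (subst \<open>(g (t + k) - g t) / k = _\<close>) (simp add: algebra_simps)
    qed
    ultimately show ?thesis by (simp only: DERIV_def)
  qed
  then obtain z where "g (norm h) - g 0 = (norm h - 0) * g' z"
    using MVT2[of 0 "norm h" g g'] False by auto
  moreover have "g' z \<le> M"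
  proof -
    have "test_field (\<lambda>x. \<psi> (x + z *\<^sub>R e) *\<^sub>R e)"
      using C1c_compose_shift_linear(1)[OF \<psi>(1) bounded_linear_scaleR_left[of e], of "z *\<^sub>R e"] \<psi>(2) e
      by (simp add: test_field_iff_C1c)
    from tv[OF this] show ?thesis by (simp add: g'_def divergence_scaleR_const[OF C])
  qed
  ultimately have "g (norm h) - g 0 \<le> norm h * M" by (simp add: mult_left_mono)
  then show ?thesis by (simp add: g_def e(2))
qed simp

lemma L1_translation_le_total_variation:
  fixes u :: "'a::euclidean_space \<Rightarrow> real"
  assumes u: "integrable lborel u"
    and tv: "\<And>\<phi>. test_field \<phi> \<Longrightarrow> (\<integral>x. u x * divergence \<phi> x \<partial>lborel) \<le> M"
  shows "(\<integral>x. \<bar>u (x + h) - u x\<bar> \<partial>lborel) \<le> norm h * M"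
proof (rule L1_norm_le_by_duality)
  have meas[measurable]: "u \<in> borel_measurable borel" using u by (simp add: integrable_iff_bounded)
  have ush: "integrable lborel (\<lambda>x. u (x + h))" using u by (simp add: integral_lborel_translate)
  then show "integrable lborel (\<lambda>x. u (x + h) - u x)" using u by auto
  fix \<psi> :: "'a \<Rightarrow> real" assume \<psi>: "C1c \<psi>" "\<And>x. \<bar>\<psi> x\<bar> \<le> 1"
  have [measurable]: "\<psi> \<in> borel_measurable borel"
    using C1c_continuous[OF \<psi>(1)] by (simp add: borel_measurable_continuous_onI)
  have i1: "integrable lborel (\<lambda>x. u (x + h) * \<psi> x)" "integrable lborel (\<lambda>x. u x * \<psi> x)"
    by (rule integrable_mult_bounded[where B = 1], use u ush \<psi>(2) in auto)+
  \<comment> \<open>Substitution moves the shift from \<open>u\<close> to \<open>\<psi>\<close> with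
    opposite sign, which leaves its norm unchanged.\<close>
  have "(\<integral>x. u (x + h) * \<psi> x \<partial>lborel) = (\<integral>x. u (x + h) * \<psi> ((x + h) + - h) \<partial>lborel)"
    by simp
  also have "\<dots> = (\<integral>x. u x * \<psi> (x + - h) \<partial>lborel)"
    by (rule integral_lborel_translate(1)) measurable
  finally have "(\<integral>x. (u (x + h) - u x) * \<psi> x \<partial>lborel)
      = (\<integral>x. u x * \<psi> (x + - h) \<partial>lborel) - (\<integral>x. u x * \<psi> x \<partial>lborel)"
    using i1 by (simp add: left_diff_distrib)
  also have "\<dots> \<le> norm (- h) * M" by (rule translated_pairing_le[OF u tv \<psi>])
  finally show "(\<integral>x. (u (x + h) - u x) * \<psi> x \<partial>lborel) \<le> norm h * M" by simp
qed

section \<open>Riesz-Fischer completeness and Kolmogorov-Riesz compactness\<close>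

section \<open>Compactness in L1\<close>

text \<open>A subsequence with gaps at most \<open>(1/2)^k\<close> has an a.e. absolutely convergent
  telescoping series, and the sum of the absolute values is an integrable majorant.\<close>

lemma L1_complete:
  fixes f :: "nat \<Rightarrow> 'a \<Rightarrow> real"
  assumes f: "\<And>n. integrable M (f n)"
    and Cauchy: "\<And>e. e > 0 \<Longrightarrow> \<exists>N. \<forall>m\<ge>N. \<forall>n\<ge>N. (\<integral>x. \<bar>f m x - f n x\<bar> \<partial>M) < e"
  obtains g where "integrable M g" "(\<lambda>n. \<integral>x. \<bar>f n x - g x\<bar> \<partial>M) \<longlonglongrightarrow> 0"
proof -
  have meas[measurable]: "f n \<in> borel_measurable M" for n using f by auto
  have "\<exists>N. \<forall>m\<ge>N. \<forall>n\<ge>N. (\<integral>x. \<bar>f m x - f n x\<bar> \<partial>M) < (1/2)^k" for k :: nat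
    by (rule Cauchy) simp
  then obtain N where N: "\<And>k m n. m \<ge> N k \<Longrightarrow> n \<ge> N k \<Longrightarrow> (\<integral>x. \<bar>f m x - f n x\<bar> \<partial>M) < (1/2)^k"
    by metis
  \<comment> \<open>The sum makes \<open>r\<close> monotone with \<open>r k\<close> at least
    \<open>N k\<close>; the summand \<open>k\<close> ensures that late subsequence indices pass any
    given threshold.\<close>
  define r where "r = (\<lambda>k. k + (\<Sum>j\<le>k. N j))"
  have rN: "N k \<le> r k" for k unfolding r_def by (intro trans_le_add2 member_le_sum) auto
  have r_ge: "k \<le> r k" for k unfolding r_def by simp
  have r_Suc: "r k \<le> r (Suc k)" for k unfolding r_def by simp
  define d where "d = (\<lambda>k x. f (r (Suc k)) x - f (r k) x)"
  have d: "integrable M (d k)" for k unfolding d_def using f by auto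
  have [measurable]: "d k \<in> borel_measurable M" for k using d by auto
  have d_small: "(\<integral>x. norm (d k x) \<partial>M) \<le> (1/2)^k" for k
    using N[of k "r (Suc k)" "r k"] rN[of k] r_Suc[of k] by (simp add: d_def)
  have sum_int: "summable (\<lambda>k. \<integral>x. norm (d k x) \<partial>M)"
    by (rule summable_comparison_test'[of "\<lambda>k. (1/2)^k" 0]) (use d_small in \<open>auto simp: summable_geometric\<close>)
  \<comment> \<open>The series of norms has finite integral by exchange of sum and integral, hence
    is finite a.e.\<close>
  have sum_AE: "AE x in M. summable (\<lambda>k. norm (d k x))"
  proof -
    have "(\<integral>\<^sup>+x. (\<Sum>k. ennreal (norm (d k x))) \<partial>M) = (\<Sum>k. \<integral>\<^sup>+x. ennreal (norm (d k x)) \<partial>M)"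
      by (rule nn_integral_suminf) measurable
    also have "\<dots> = (\<Sum>k. ennreal (\<integral>x. norm (d k x) \<partial>M))"
      using d by (intro suminf_cong nn_integral_eq_integral) auto
    also have "\<dots> = ennreal (\<Sum>k. \<integral>x. norm (d k x) \<partial>M)"
      by (rule suminf_ennreal2) (use sum_int in auto)
    finally have "(\<integral>\<^sup>+x. (\<Sum>k. ennreal (norm (d k x))) \<partial>M) \<noteq> \<infinity>" by simp
    then have "AE x in M. (\<Sum>k. ennreal (norm (d k x))) \<noteq> \<infinity>"
      by (intro nn_integral_PInf_AE) auto
    then show ?thesis
    proof eventually_elim
      fix x assume "(\<Sum>k. ennreal (norm (d k x))) \<noteq> \<infinity>"
      then show "summable (\<lambda>k. norm (d k x))"
        by (intro summable_suminf_not_top) auto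
    qed
  qed
  define g where "g = (\<lambda>x. f (r 0) x + (\<Sum>k. d k x))"
  have "integrable M (\<lambda>x. \<Sum>k. d k x)" by (rule integrable_suminf[OF d sum_AE sum_int])
  then have g: "integrable M g" unfolding g_def using f by auto
  have w: "integrable M (\<lambda>x. \<Sum>k. norm (d k x))"
    by (rule integrable_suminf) (use d sum_AE sum_int in auto)
  have tele: "f (r n) x = f (r 0) x + (\<Sum>k<n. d k x)" for n x
    by (induction n) (auto simp: d_def)
  have sub: "(\<lambda>n. \<integral>x. \<bar>f (r n) x - g x\<bar> \<partial>M) \<longlonglongrightarrow> (\<integral>x. 0 \<partial>M)"
  proof (rule integral_dominated_convergence[OF _ _ w])
    show "AE x in M. (\<lambda>n. \<bar>f (r n) x - g x\<bar>) \<longlonglongrightarrow> 0"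
      using sum_AE
    proof eventually_elim
      fix x assume "summable (\<lambda>k. norm (d k x))"
      then have "(\<lambda>n. \<Sum>k<n. d k x) \<longlonglongrightarrow> (\<Sum>k. d k x)"
        by (rule summable_LIMSEQ[OF summable_norm_cancel])
      then have "(\<lambda>n. f (r 0) x + (\<Sum>k<n. d k x)) \<longlonglongrightarrow> f (r 0) x + (\<Sum>k. d k x)"
        by (rule tendsto_add[OF tendsto_const])
      then have "(\<lambda>n. f (r n) x) \<longlonglongrightarrow> g x" by (simp only: g_def tele[symmetric])
      then show "(\<lambda>n. \<bar>f (r n) x - g x\<bar>) \<longlonglongrightarrow> 0"
        by (intro tendsto_rabs_zero) (simp add: LIM_zero)
    qed
    show "AE x in M. norm \<bar>f (r n) x - g x\<bar> \<le> (\<Sum>k. norm (d k x))" for n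
      using sum_AE
    proof eventually_elim
      fix x assume S: "summable (\<lambda>k. norm (d k x))"
      then have S': "summable (\<lambda>k. d k x)" by (rule summable_norm_cancel)
      have "f (r n) x - g x = - (\<Sum>k. d (k + n) x)"
        unfolding g_def tele[of n] using suminf_split_initial_segment[OF S', of n] by linarith
      then have "norm \<bar>f (r n) x - g x\<bar> = norm (\<Sum>k. d (k + n) x)"
        by (simp only: real_norm_def abs_minus_cancel abs_abs)
      also have "\<dots> \<le> (\<Sum>k. norm (d (k + n) x))"
        by (rule summable_norm[OF summable_ignore_initial_segment[OF S]])
      also have "\<dots> \<le> (\<Sum>k. norm (d k x))"
        using suminf_split_initial_segment[OF S, of n] by (simp add: sum_nonneg)
      finally show "norm \<bar>f (r n) x - g x\<bar> \<le> (\<Sum>k. norm (d k x))" .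
    qed
  qed (use g in auto)
  have "(\<lambda>n. \<integral>x. \<bar>f n x - g x\<bar> \<partial>M) \<longlonglongrightarrow> 0"
  proof (rule LIMSEQ_I)
    fix e :: real assume e: "e > 0"
    obtain N1 where N1: "\<forall>m\<ge>N1. \<forall>n\<ge>N1. (\<integral>x. \<bar>f m x - f n x\<bar> \<partial>M) < e / 2"
      using Cauchy[of "e/2"] e by auto
    obtain N2 where N2: "\<forall>n\<ge>N2. \<bar>\<integral>x. \<bar>f (r n) x - g x\<bar> \<partial>M\<bar> < e / 2"
      using LIMSEQ_D[OF sub, of "e/2"] e by auto
    have "(\<integral>x. \<bar>f n x - g x\<bar> \<partial>M) < e" if n: "n \<ge> N1" for n
    proof -
      \<comment> \<open>Late enough both for the Cauchy bound and for the convergence of the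
        subsequence.\<close>
      let ?k = "max N1 N2"
      have "(\<integral>x. \<bar>f n x - g x\<bar> \<partial>M) \<le> (\<integral>x. \<bar>f n x - f (r ?k) x\<bar> + \<bar>f (r ?k) x - g x\<bar> \<partial>M)"
        using f g by (intro integral_mono) auto
      also have "\<dots> = (\<integral>x. \<bar>f n x - f (r ?k) x\<bar> \<partial>M) + (\<integral>x. \<bar>f (r ?k) x - g x\<bar> \<partial>M)"
        using f g by (intro Bochner_Integration.integral_add) auto
      also have "(\<integral>x. \<bar>f n x - f (r ?k) x\<bar> \<partial>M) < e / 2"
        using N1 n r_ge[of ?k] by auto
      also have "(\<integral>x. \<bar>f (r ?k) x - g x\<bar> \<partial>M) < e / 2"
        using N2[rule_format, of ?k] by simp
      finally show ?thesis by simp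
    qed
    then show "\<exists>no. \<forall>n\<ge>no. norm ((\<integral>x. \<bar>f n x - g x\<bar> \<partial>M) - 0) < e"
      by (intro exI[of _ N1]) simp
  qed
  with g show ?thesis by (rule that)
qed

text \<open>Left unnormalised: its supremum is bounded by the L1 norm of \<open>u\<close> and its
  Lipschitz constant by \<open>M\<close>, both independent of \<open>r\<close>. The ball volume
  enters only in the error estimate.\<close>

definition ball_integral :: "real \<Rightarrow> ('a::euclidean_space \<Rightarrow> real) \<Rightarrow> 'a \<Rightarrow> real" where
  "ball_integral r u x = (\<integral>z. indicator (ball 0 r) z * u (x + z) \<partial>lborel)"

lemma integrable_indicator_mult:
  fixes f :: "'a \<Rightarrow> real"
  assumes "integrable M f" "A \<in> sets M"
  shows "integrable M (\<lambda>x. indicator A x * f x)"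
  using integrable_mult_indicator[OF assms(2,1)] by simp

lemma integrable_lborel_add:
  fixes u :: "'a::euclidean_space \<Rightarrow> real"
  assumes "integrable lborel u"
  shows "integrable lborel (\<lambda>z. u (x + z))"
  using assms integral_lborel_translate(2)[of u x] by (simp add: add.commute integrable_iff_bounded)

lemma integral_lborel_add:
  fixes u :: "'a::euclidean_space \<Rightarrow> real"
  assumes "u \<in> borel_measurable borel"
  shows "(\<integral>z. u (x + z) \<partial>lborel) = (\<integral>z. u z \<partial>lborel)"
  using integral_lborel_translate(1)[OF assms, of x] by (simp add: add.commute)

lemma abs_ball_integral_le:
  fixes u :: "'a::euclidean_space \<Rightarrow> real"
  assumes u: "integrable lborel u"
  shows "\<bar>ball_integral r u x\<bar> \<le> (\<integral>x. \<bar>u x\<bar> \<partial>lborel)"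
proof -
  have "\<bar>ball_integral r u x\<bar> \<le> (\<integral>z. \<bar>indicator (ball 0 r) z * u (x + z)\<bar> \<partial>lborel)"
    unfolding ball_integral_def by (rule integral_abs_bound)
  also have "\<dots> \<le> (\<integral>z. \<bar>u (x + z)\<bar> \<partial>lborel)"
    using integrable_lborel_add[OF u, of x]
    by (intro integral_mono integrable_abs integrable_indicator_mult) (auto simp: indicator_def)
  also have "\<dots> = (\<integral>z. \<bar>u z\<bar> \<partial>lborel)"
    using u by (intro integral_lborel_add) (auto simp: integrable_iff_bounded)
  finally show ?thesis .
qed

text \<open>Only the translates of \<open>u\<close> depend on the centre. Enlarging the ball to the
  whole space turns the difference into a translation by \<open>x - y\<close>.\<close>

lemma ball_integral_lipschitz:
  fixes u :: "'a::euclidean_space \<Rightarrow> real"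
  assumes u: "integrable lborel u"
    and transl: "\<And>h. (\<integral>x. \<bar>u (x + h) - u x\<bar> \<partial>lborel) \<le> norm h * M"
  shows "\<bar>ball_integral r u x - ball_integral r u y\<bar> \<le> norm (x - y) * M"
proof -
  have [measurable]: "u \<in> borel_measurable borel" using u by (simp add: integrable_iff_bounded)
  note i = integrable_lborel_add[OF u]
  have "ball_integral r u x - ball_integral r u y
      = (\<integral>z. indicator (ball 0 r) z * u (x + z) - indicator (ball 0 r) z * u (y + z) \<partial>lborel)"
    unfolding ball_integral_def
    by (rule Bochner_Integration.integral_diff[symmetric]) (auto intro!: integrable_indicator_mult i)
  also have "\<bar>\<dots>\<bar> \<le> (\<integral>z. \<bar>indicator (ball 0 r) z * u (x + z) - indicator (ball 0 r) z * u (y + z)\<bar> \<partial>lborel)"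
    by (rule integral_abs_bound)
  also have "\<dots> \<le> (\<integral>z. \<bar>u (y + z + (x - y)) - u (y + z)\<bar> \<partial>lborel)"
  proof (rule integral_mono)
    show "integrable lborel (\<lambda>z. \<bar>indicator (ball 0 r) z * u (x + z) - indicator (ball 0 r) z * u (y + z)\<bar>)"
      by (intro integrable_abs Bochner_Integration.integrable_diff integrable_indicator_mult i) auto
    show "integrable lborel (\<lambda>z. \<bar>u (y + z + (x - y)) - u (y + z)\<bar>)"
      using i[of x] i[of y] by (simp add: algebra_simps)
  qed (auto simp: indicator_def algebra_simps)
  also have "\<dots> = (\<integral>z. \<bar>u (z + (x - y)) - u z\<bar> \<partial>lborel)"
    by (rule integral_lborel_add[of "\<lambda>z. \<bar>u (z + (x - y)) - u z\<bar>" y]) measurable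
  also have "\<dots> \<le> norm (x - y) * M" by (rule transl)
  finally show ?thesis .
qed

lemma borel_measurable_ball_integral:
  fixes u :: "'a::euclidean_space \<Rightarrow> real"
  assumes [measurable]: "u \<in> borel_measurable borel"
  shows "ball_integral r u \<in> borel_measurable borel"
proof -
  have [measurable]: "indicat_real (ball (0::'a) r) \<in> borel_measurable borel"
    by (intro borel_measurable_indicator) auto
  have "(\<lambda>w. indicat_real (ball (0::'a) r) (snd w)) \<in> borel_measurable (borel \<Otimes>\<^sub>M borel :: ('a \<times> 'a) measure)"
    by (rule measurable_compose[OF measurable_snd]) fact
  moreover have "(\<lambda>w. u (fst w + snd w)) \<in> borel_measurable (borel \<Otimes>\<^sub>M borel)"
    by measurable
  ultimately have "(\<lambda>w. indicator (ball 0 r) (snd w) * u (fst w + snd w)) \<in> borel_measurable (borel \<Otimes>\<^sub>M borel)"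
    by (rule borel_measurable_times)
  moreover have "sets (borel \<Otimes>\<^sub>M lborel :: ('a \<times> 'a) measure) = sets (borel \<Otimes>\<^sub>M borel)"
    by (rule sets_pair_measure_cong) auto
  ultimately have "(\<lambda>(x, z). indicator (ball 0 r) z * u (x + z)) \<in> borel_measurable (borel \<Otimes>\<^sub>M lborel)"
    by (simp add: case_prod_beta' cong: measurable_cong_sets)
  from lborel.borel_measurable_lebesgue_integral[OF this]
  have "(\<lambda>x. \<integral>z. indicator (ball 0 r) z * u (x + z) \<partial>lborel) \<in> borel_measurable borel" .
  then show ?thesis by (simp add: ball_integral_def[abs_def])
qed

text \<open>The error is an average of \<open>u x - u (x + z)\<close> over the ball. Exchanging the
  two integrals leaves the mean over z of translation differences, each at most
  \<open>norm z * M\<close>, hence at most \<open>r * M\<close>. Nonnegative integrals are used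
  throughout because integrability is part of the claim.\<close>

lemma ball_average_L1_error:
  fixes u :: "'a::euclidean_space \<Rightarrow> real"
  assumes u: "integrable lborel u" and r: "r > 0"
    and transl: "\<And>h. (\<integral>x. \<bar>u (x + h) - u x\<bar> \<partial>lborel) \<le> norm h * M" and M: "M \<ge> 0"
  defines "B \<equiv> measure lborel (ball (0::'a) r)"
  shows "integrable lborel (\<lambda>x. u x - ball_integral r u x / B)"
    and "(\<integral>x. \<bar>u x - ball_integral r u x / B\<bar> \<partial>lborel) \<le> r * M"
proof -
  have [measurable]: "u \<in> borel_measurable borel" using u by (simp add: integrable_iff_bounded)
  note [measurable] = borel_measurable_ball_integral
  have B: "B > 0" unfolding B_def using r content_ball_pos[of r "0::'a"] by simp
  have em: "emeasure lborel (ball (0::'a) r) = ennreal B"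
    unfolding B_def by (rule emeasure_eq_ennreal_measure) (use emeasure_lborel_ball_finite[of "0::'a" r] in auto)
  let ?F = "\<lambda>x z. ennreal (indicator (ball 0 r) z * \<bar>u (x + z) - u x\<bar> / B)"
  have pt: "ennreal \<bar>u x - ball_integral r u x / B\<bar> \<le> (\<integral>\<^sup>+z. ?F x z \<partial>lborel)" for x
  proof -
    have i1: "integrable lborel (\<lambda>z. indicator (ball 0 r) z * u (x + z))"
      by (intro integrable_indicator_mult integrable_lborel_add u) auto
    have i2: "integrable lborel (\<lambda>z. indicator (ball (0::'a) r) z * u x)"
      using em by (intro integrable_mult_left integrable_real_indicator) auto
    \<comment> \<open>The constant \<open>u x\<close> is its own average, so both terms can be put
      under one integral in \<open>z\<close>.\<close>
    have "u x = (\<integral>z. indicator (ball (0::'a) r) z * u x \<partial>lborel) / B"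
      using B by (simp add: B_def)
    then have "ball_integral r u x / B - u x
        = (\<integral>z. indicator (ball 0 r) z * u (x + z) - indicator (ball 0 r) z * u x \<partial>lborel) / B"
      unfolding ball_integral_def using i1 i2 by (simp add: diff_divide_distrib)
    also have "\<dots> = (\<integral>z. indicator (ball 0 r) z * (u (x + z) - u x) / B \<partial>lborel)"
      by (simp add: right_diff_distrib)
    finally have eq: "ball_integral r u x / B - u x = \<dots>" .
    have i3: "integrable lborel (\<lambda>z. indicator (ball 0 r) z * (u (x + z) - u x) / B)"
      using i1 i2 by (simp add: right_diff_distrib)
    have "ennreal \<bar>u x - ball_integral r u x / B\<bar> = ennreal (norm (\<integral>z. indicator (ball 0 r) z * (u (x + z) - u x) / B \<partial>lborel))"
      unfolding eq[symmetric] by (simp add: abs_minus_commute)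
    also have "\<dots> \<le> (\<integral>\<^sup>+z. ennreal (norm (indicator (ball 0 r) z * (u (x + z) - u x) / B)) \<partial>lborel)"
      by (rule integral_norm_bound_ennreal[OF i3])
    also have "\<dots> = (\<integral>\<^sup>+z. ?F x z \<partial>lborel)"
      using B by (simp add: abs_mult)
    finally show ?thesis .
  qed
  have "(\<integral>\<^sup>+x. ennreal \<bar>u x - ball_integral r u x / B\<bar> \<partial>lborel) \<le> (\<integral>\<^sup>+x. \<integral>\<^sup>+z. ?F x z \<partial>lborel \<partial>lborel)"
    by (rule nn_integral_mono) (rule pt)
  also have "\<dots> = (\<integral>\<^sup>+z. \<integral>\<^sup>+x. ?F x z \<partial>lborel \<partial>lborel)"
  proof (rule lborel_pair.Fubini'[symmetric])
    have [measurable]: "indicat_real (ball (0::'a) r) \<in> borel_measurable borel"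
      by (intro borel_measurable_indicator) auto
    have "(\<lambda>w. indicat_real (ball (0::'a) r) (snd w)) \<in> borel_measurable (borel \<Otimes>\<^sub>M borel :: ('a \<times> 'a) measure)"
      by (rule measurable_compose[OF measurable_snd]) fact
    moreover have "(\<lambda>w. \<bar>u (fst w + snd w) - u (fst w)\<bar> / B) \<in> borel_measurable (borel \<Otimes>\<^sub>M borel)"
      by measurable
    ultimately have "(\<lambda>w. indicator (ball 0 r) (snd w) * (\<bar>u (fst w + snd w) - u (fst w)\<bar> / B)) \<in> borel_measurable (borel \<Otimes>\<^sub>M borel)"
      by (rule borel_measurable_times)
    then have "(\<lambda>w. ?F (fst w) (snd w)) \<in> borel_measurable (borel \<Otimes>\<^sub>M borel)"
      by (intro measurable_compose[OF _ measurable_ennreal]) simp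
    moreover have "sets (lborel \<Otimes>\<^sub>M lborel :: ('a \<times> 'a) measure) = sets (borel \<Otimes>\<^sub>M borel)"
      by (rule sets_pair_measure_cong) auto
    ultimately show "(\<lambda>(x, z). ?F x z) \<in> borel_measurable (lborel \<Otimes>\<^sub>M lborel)"
      by (simp add: case_prod_beta' cong: measurable_cong_sets)
  qed
  also have "\<dots> \<le> (\<integral>\<^sup>+z. ennreal (r * M / B) * indicator (ball (0::'a) r) z \<partial>lborel)"
  proof (rule nn_integral_mono)
    fix z :: 'a
    have i: "integrable lborel (\<lambda>x. \<bar>u (x + z) - u x\<bar> / B)"
      using u integral_lborel_translate(2)[of u z] by auto
    show "(\<integral>\<^sup>+x. ?F x z \<partial>lborel) \<le> ennreal (r * M / B) * indicator (ball (0::'a) r) z"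
    proof (cases "z \<in> ball 0 r")
      case True
      then have "(\<integral>\<^sup>+x. ?F x z \<partial>lborel) = (\<integral>\<^sup>+x. ennreal (\<bar>u (x + z) - u x\<bar> / B) \<partial>lborel)" by simp
      also have "\<dots> = ennreal (\<integral>x. \<bar>u (x + z) - u x\<bar> / B \<partial>lborel)"
        using i B by (intro nn_integral_eq_integral) auto
      also have "(\<integral>x. \<bar>u (x + z) - u x\<bar> / B \<partial>lborel) \<le> r * M / B"
      proof -
        have "norm z * M \<le> r * M" using True M by (intro mult_right_mono) auto
        then have "(\<integral>x. \<bar>u (x + z) - u x\<bar> \<partial>lborel) \<le> r * M" using transl[of z] by linarith
        then show ?thesis using B by (simp add: divide_right_mono)
      qed
      finally show ?thesis using True by (simp add: ennreal_leI)
    qed simp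
  qed
  also have "\<dots> = ennreal (r * M / B) * ennreal B"
    using em by (subst nn_integral_cmult_indicator) auto
  also have "\<dots> = ennreal (r * M)"
    using B r M by (simp add: ennreal_mult[symmetric])
  finally have le: "(\<integral>\<^sup>+x. ennreal \<bar>u x - ball_integral r u x / B\<bar> \<partial>lborel) \<le> ennreal (r * M)" .
  show int: "integrable lborel (\<lambda>x. u x - ball_integral r u x / B)"
    by (rule integrableI_bounded) (use le in \<open>auto intro: le_less_trans\<close>)
  have "(\<integral>\<^sup>+x. ennreal \<bar>u x - ball_integral r u x / B\<bar> \<partial>lborel) = ennreal (\<integral>x. \<bar>u x - ball_integral r u x / B\<bar> \<partial>lborel)"
    using int by (intro nn_integral_eq_integral) auto
  with le show "(\<integral>x. \<bar>u x - ball_integral r u x / B\<bar> \<partial>lborel) \<le> r * M"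
    using r M by (simp add: ennreal_le_iff)
qed

text \<open>All components share one subsequence, since the disjointness constraint couples them in
  the limit.\<close>

lemma L1_compactness_of_translation_lipschitz:
  fixes u :: "nat \<Rightarrow> 'n::finite \<Rightarrow> 'a::euclidean_space \<Rightarrow> real"
  assumes \<Omega>: "bounded \<Omega>" "\<Omega> \<in> sets borel"
    and u: "\<And>k i. integrable lborel (u k i)"
    and C: "\<And>k i. (\<integral>x. \<bar>u k i x\<bar> \<partial>lborel) \<le> C"
    and transl: "\<And>k i h. (\<integral>x. \<bar>u k i (x + h) - u k i x\<bar> \<partial>lborel) \<le> norm h * M" and M: "M \<ge> 0"
    and off: "\<And>k i. AE x in lborel. x \<notin> \<Omega> \<longrightarrow> u k i x = 0"
  obtains r g where "strict_mono (r :: nat \<Rightarrow> nat)" "\<And>i. integrable lborel (g i)"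
    "\<And>i. (\<lambda>n. \<integral>x. \<bar>u (r n) i x - g i x\<bar> \<partial>lborel) \<longlonglongrightarrow> 0"
proof -
  define \<rho> where "\<rho> = (\<lambda>m::nat. 1 / real (Suc m))"
  obtain D :: "'a set" where D: "countable D" "\<And>X. open X \<Longrightarrow> X \<noteq> {} \<Longrightarrow> \<exists>d\<in>D. d \<in> X"
    by (rule countable_dense_setE) blast
  \<comment> \<open>Indices are triples of component, radius and point of the dense set, so a single
    diagonal extraction serves all of them.\<close>
  have "countable (UNIV \<times> UNIV \<times> D :: ('n \<times> nat \<times> 'a) set)"
    using D(1) by (intro countable_SIGMA) auto
  then obtain r where r: "strict_mono (r :: nat \<Rightarrow> nat)"
    and conv: "\<And>w. w \<in> UNIV \<times> UNIV \<times> D \<Longrightarrow>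
      \<exists>l. (\<lambda>n. ball_integral (\<rho> (fst (snd w))) (u (r n) (fst w)) (snd (snd w))) \<longlonglongrightarrow> l"
  proof (rule function_convergent_subsequence
      [where f = "\<lambda>n w. ball_integral (\<rho> (fst (snd w))) (u n (fst w)) (snd (snd w))" and M = C])
    show "norm (ball_integral (\<rho> (fst (snd w))) (u n (fst w)) (snd (snd w))) \<le> C" for n w
      unfolding real_norm_def using abs_ball_integral_le[OF u] C by (rule order_trans)
  qed blast
  have conv_D: "convergent (\<lambda>n. ball_integral (\<rho> m) (u (r n) i) d)" if "d \<in> D" for i m d
    using conv[of "(i, m, d)"] that by (auto simp: convergent_def)
  have conv_all: "convergent (\<lambda>n. ball_integral (\<rho> m) (u (r n) i) x)" for i m x
  proof (rule Cauchy_convergent, rule metric_CauchyI)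
    fix e :: real assume e: "e > 0"
    \<comment> \<open>\<open>M + 1\<close> in place of \<open>M\<close> avoids division by zero when
      \<open>M = 0\<close>.\<close>
    have "e / (3 * (M + 1)) > 0" using e M by simp
    then have "ball x (e / (3 * (M + 1))) \<noteq> {}" by (metis centre_in_ball empty_iff)
    then obtain d where d: "d \<in> D" "d \<in> ball x (e / (3 * (M + 1)))" using D(2) open_ball by meson
    have "norm (x - d) * M \<le> norm (x - d) * (M + 1)" by (intro mult_left_mono) auto
    also have "\<dots> < e / 3"
      using d(2) M by (simp add: dist_norm field_simps)
    finally have near: "\<bar>ball_integral (\<rho> m) (u (r n) i) x - ball_integral (\<rho> m) (u (r n) i) d\<bar> < e / 3" for n
      using ball_integral_lipschitz[OF u transl] by (meson le_less_trans)
    obtain N where N: "\<And>p q. p \<ge> N \<Longrightarrow> q \<ge> N \<Longrightarrow>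
        dist (ball_integral (\<rho> m) (u (r p) i) d) (ball_integral (\<rho> m) (u (r q) i) d) < e / 3"
      using metric_CauchyD[OF convergent_Cauchy[OF conv_D[OF d(1)]], of "e/3"] e by (metis divide_pos_pos zero_less_numeral)
    show "\<exists>N. \<forall>p\<ge>N. \<forall>q\<ge>N. dist (ball_integral (\<rho> m) (u (r p) i) x) (ball_integral (\<rho> m) (u (r q) i) x) < e"
    proof (intro exI[of _ N] allI impI)
      fix p q assume "p \<ge> N" "q \<ge> N"
      then show "dist (ball_integral (\<rho> m) (u (r p) i) x) (ball_integral (\<rho> m) (u (r q) i) x) < e"
        using N[of p q] near[of p] near[of q] unfolding dist_real_def by linarith
    qed
  qed
  have fin: "emeasure lborel \<Omega> < \<infinity>" using \<Omega>(1) by (rule emeasure_bounded_finite)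
  \<comment> \<open>Only a uniform bound on the averages is at hand, so dominated convergence is
    confined to \<Omega>, whose finite measure makes \<open>2 * C\<close> integrable there.\<close>
  have Cauchy_av: "\<exists>N. \<forall>p\<ge>N. \<forall>q\<ge>N.
      (\<integral>x. indicator \<Omega> x * \<bar>ball_integral (\<rho> m) (u (r p) i) x - ball_integral (\<rho> m) (u (r q) i) x\<bar> \<partial>lborel) < e"
    if e: "e > 0" for e i m
  proof -
    define b where "b = (\<lambda>n. ball_integral (\<rho> m) (u (r n) i))"
    have [measurable]: "b n \<in> borel_measurable borel" for n
      unfolding b_def using u by (intro borel_measurable_ball_integral) (simp add: integrable_iff_bounded)
    define l where "l = (\<lambda>x. lim (\<lambda>n. b n x))"
    have bl: "(\<lambda>n. b n x) \<longlonglongrightarrow> l x" for x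
      using conv_all by (simp add: l_def b_def convergent_LIMSEQ_iff)
    have [measurable]: "l \<in> borel_measurable borel"
      by (rule borel_measurable_LIMSEQ_real[OF bl]) measurable
    have bC: "\<bar>b n x\<bar> \<le> C" for n x
      unfolding b_def using abs_ball_integral_le[OF u] C by (rule order_trans)
    have lC: "\<bar>l x\<bar> \<le> C" for x
      by (rule LIMSEQ_le_const2[OF tendsto_rabs[OF bl]]) (use bC in auto)
    note [measurable] = \<Omega>(2)
    have iC: "integrable lborel (\<lambda>x. indicator \<Omega> x * (2 * C))"
      using \<Omega>(2) fin by (intro integrable_mult_left integrable_real_indicator) auto
    have bd: "norm (indicator \<Omega> x * \<bar>b n x - l x\<bar>) \<le> indicator \<Omega> x * (2 * C)" for n x
      using bC[of n x] lC[of x] by (auto simp: indicator_def)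
    have int: "integrable lborel (\<lambda>x. indicator \<Omega> x * \<bar>b n x - l x\<bar>)" for n
    proof (rule Bochner_Integration.integrable_bound[OF iC])
      show "AE x in lborel. norm (indicator \<Omega> x * \<bar>b n x - l x\<bar>) \<le> norm (indicator \<Omega> x * (2 * C))"
        by (rule AE_I2, rule order_trans[OF bd]) simp
    qed measurable
    have "(\<lambda>n. \<integral>x. indicator \<Omega> x * \<bar>b n x - l x\<bar> \<partial>lborel) \<longlonglongrightarrow> (\<integral>x. 0 \<partial>(lborel :: 'a measure))"
    proof (rule integral_dominated_convergence[OF _ _ iC])
      show "AE x in lborel. (\<lambda>n. indicator \<Omega> x * \<bar>b n x - l x\<bar>) \<longlonglongrightarrow> 0"
        by (intro AE_I2 tendsto_mult_right_zero tendsto_rabs_zero LIM_zero bl)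
    qed (measurable, use bd in auto)
    then obtain N where N: "\<And>n. n \<ge> N \<Longrightarrow> \<bar>\<integral>x. indicator \<Omega> x * \<bar>b n x - l x\<bar> \<partial>lborel\<bar> < e / 2"
      using LIMSEQ_D[of _ _ "e/2"] e by fastforce
    have "(\<integral>x. indicator \<Omega> x * \<bar>b p x - b q x\<bar> \<partial>lborel) < e" if "p \<ge> N" "q \<ge> N" for p q
    proof -
      have "(\<integral>x. indicator \<Omega> x * \<bar>b p x - b q x\<bar> \<partial>lborel)
          \<le> (\<integral>x. indicator \<Omega> x * \<bar>b p x - l x\<bar> + indicator \<Omega> x * \<bar>b q x - l x\<bar> \<partial>lborel)"
        by (rule integral_mono_AE') (use int in \<open>auto simp: indicator_def\<close>)
      also have "\<dots> < e" using N[OF that(1)] N[OF that(2)] int by simp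
      finally show ?thesis .
    qed
    then show ?thesis unfolding b_def by blast
  qed
  have Cauchy_u: "\<exists>N. \<forall>p\<ge>N. \<forall>q\<ge>N. (\<integral>x. \<bar>u (r p) i x - u (r q) i x\<bar> \<partial>lborel) < e" if e: "e > 0" for e i
  proof -
    \<comment> \<open>The radius comes first, making the averaging error less than
      \<open>e / 3\<close> along the whole sequence; \<open>N\<close> is then chosen for this
      radius.\<close>
    obtain m where m: "\<rho> m * (3 * (M + 1)) < e"
    proof -
      obtain m where "inverse (real (Suc m)) < e / (3 * (M + 1))"
        using reals_Archimedean[of "e / (3 * (M + 1))"] e M by auto
      then show ?thesis using that[of m] M by (simp add: \<rho>_def field_simps)
    qed
    have \<rho>: "\<rho> m > 0" by (simp add: \<rho>_def)
    then have m': "\<rho> m * M < e / 3" using m M by (simp add: algebra_simps)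
    define B where "B = measure lborel (ball (0::'a) (\<rho> m))"
    have B: "B > 0" unfolding B_def using \<rho> content_ball_pos[of "\<rho> m" "0::'a"] by simp
    define a where "a = (\<lambda>n x. ball_integral (\<rho> m) (u (r n) i) x)"
    have err: "integrable lborel (\<lambda>x. u (r n) i x - a n x / B)"
      "(\<integral>x. \<bar>u (r n) i x - a n x / B\<bar> \<partial>lborel) < e / 3" for n
      using ball_average_L1_error[OF u[of "r n" i] \<rho> transl M] m' unfolding a_def B_def by (auto intro: le_less_trans)
    \<comment> \<open>\<open>a\<close> is not normalised, so the target \<open>e / 3\<close> is
      multiplied by the ball volume \<open>B\<close>.\<close>
    obtain N where N: "\<And>p q. p \<ge> N \<Longrightarrow> q \<ge> N \<Longrightarrow> (\<integral>x. indicator \<Omega> x * \<bar>a p x - a q x\<bar> \<partial>lborel) < B * e / 3"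
      using Cauchy_av[of "B * e / 3" m i] B e unfolding a_def by auto
    have "(\<integral>x. \<bar>u (r p) i x - u (r q) i x\<bar> \<partial>lborel) < e" if "p \<ge> N" "q \<ge> N" for p q
    proof -
      have ia: "integrable lborel (\<lambda>x. a n x / B)" for n
        using Bochner_Integration.integrable_diff[OF u[of "r n" i] err(1)[of n]] by simp
      then have "integrable lborel (\<lambda>x. B * (a n x / B))" for n
        by (rule integrable_mult_right)
      then have "integrable lborel (a n)" for n
        using B by simp
      then have ia': "integrable lborel (\<lambda>x. indicator \<Omega> x * \<bar>a p x - a q x\<bar>)"
        using \<Omega>(2) by (intro integrable_indicator_mult integrable_abs Bochner_Integration.integrable_diff) auto
      \<comment> \<open>Off \<Omega> the left side is zero a.e., so the third term may carry the
        indicator.\<close>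
      have "(\<integral>x. \<bar>u (r p) i x - u (r q) i x\<bar> \<partial>lborel)
          \<le> (\<integral>x. \<bar>u (r p) i x - a p x / B\<bar> + \<bar>u (r q) i x - a q x / B\<bar> + (indicator \<Omega> x * \<bar>a p x - a q x\<bar>) / B \<partial>lborel)"
      proof (rule integral_mono_AE)
        show "integrable lborel (\<lambda>x. \<bar>u (r p) i x - u (r q) i x\<bar>)" using u by auto
        show "integrable lborel (\<lambda>x. \<bar>u (r p) i x - a p x / B\<bar> + \<bar>u (r q) i x - a q x / B\<bar> + (indicator \<Omega> x * \<bar>a p x - a q x\<bar>) / B)"
          using err(1) ia' by auto
        show "AE x in lborel. \<bar>u (r p) i x - u (r q) i x\<bar>
            \<le> \<bar>u (r p) i x - a p x / B\<bar> + \<bar>u (r q) i x - a q x / B\<bar> + (indicator \<Omega> x * \<bar>a p x - a q x\<bar>) / B"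
          using off[of "r p" i] off[of "r q" i]
        proof eventually_elim
          case (elim x)
          have "\<bar>a p x / B - a q x / B\<bar> = \<bar>a p x - a q x\<bar> / B"
            using B by (simp add: diff_divide_distrib[symmetric])
          then have "\<bar>u (r p) i x - u (r q) i x\<bar>
              \<le> \<bar>u (r p) i x - a p x / B\<bar> + \<bar>u (r q) i x - a q x / B\<bar> + \<bar>a p x - a q x\<bar> / B"
            by linarith
          with elim B show ?case by (cases "x \<in> \<Omega>") simp_all
        qed
      qed
      also have "\<dots> = (\<integral>x. \<bar>u (r p) i x - a p x / B\<bar> \<partial>lborel) + (\<integral>x. \<bar>u (r q) i x - a q x / B\<bar> \<partial>lborel)
          + (\<integral>x. indicator \<Omega> x * \<bar>a p x - a q x\<bar> \<partial>lborel) / B"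
        using err(1) ia' by simp
      also have "(\<integral>x. indicator \<Omega> x * \<bar>a p x - a q x\<bar> \<partial>lborel) / B < e / 3"
        using N[OF that] B by (simp add: field_simps)
      also note err(2)[of p]
      also note err(2)[of q]
      finally show ?thesis by simp
    qed
    then show ?thesis by blast
  qed
  have "\<exists>g. integrable lborel g \<and> (\<lambda>n. \<integral>x. \<bar>u (r n) i x - g x\<bar> \<partial>lborel) \<longlonglongrightarrow> 0" for i
    by (rule L1_complete[of lborel "\<lambda>n. u (r n) i"]) (use u Cauchy_u in auto)
  then obtain g where "\<And>i. integrable lborel (g i) \<and> (\<lambda>n. \<integral>x. \<bar>u (r n) i x - g i x\<bar> \<partial>lborel) \<longlonglongrightarrow> 0"
    by metis
  with r that show ?thesis by blast
qed

section \<open>Total variation as a supremum of pairings, and its invariance under null sets\<close>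

section \<open>Total variation\<close>

lemma divergence_bounded_continuous:
  fixes \<phi> :: "'a::euclidean_space \<Rightarrow> 'a"
  assumes "test_field \<phi>"
  obtains L where "\<And>x. \<bar>divergence \<phi> x\<bar> \<le> L" "divergence \<phi> \<in> borel_measurable borel"
proof -
  have C: "C1c \<phi>" using assms by (simp add: test_field_iff_C1c)
  then obtain L where L: "\<And>x v. norm (frechet_derivative \<phi> (at x) v) \<le> L * norm v"
    using C1c_frechet_derivative_bound by metis
  have "\<bar>divergence \<phi> x\<bar> \<le> (\<Sum>b\<in>(Basis::'a set). L)" for x
    unfolding divergence_def
  proof (rule sum_abs[THEN order_trans], rule sum_mono)
    fix b :: 'a assume b: "b \<in> Basis"
    then show "\<bar>frechet_derivative \<phi> (at x) b \<bullet> b\<bar> \<le> L"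
      using Basis_le_norm[OF b, of "frechet_derivative \<phi> (at x) b"] L[of x b] by simp
  qed
  moreover have "continuous_on UNIV (divergence \<phi>)"
    unfolding divergence_def[abs_def]
    by (intro continuous_on_sum continuous_on_inner continuous_on_const C1c_frechet_derivative_continuous[OF C])
  ultimately show ?thesis using that borel_measurable_continuous_onI by blast
qed

text \<open>The definitions integrate over \<open>lebesgue\<close>; translations and Fubini are
  carried out over \<open>lborel\<close>. For Borel functions nothing changes.\<close>

lemma integral_lebesgue_eq_lborel:
  fixes f :: "'a::euclidean_space \<Rightarrow> real"
  assumes "f \<in> borel_measurable borel"
  shows "integral\<^sup>L lebesgue f = integral\<^sup>L lborel f" "integrable lebesgue f \<longleftrightarrow> integrable lborel f"
  using assms by (auto simp: integral_completion integrable_completion)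

text \<open>Replaces the extended-real supremum by a family of real inequalities, the form used by
  the translation estimate and by the passage to the limit.\<close>

lemma total_variation_le_iff:
  fixes u :: "'a::euclidean_space \<Rightarrow> real"
  assumes u: "u \<in> borel_measurable borel"
  shows "total_variation u \<le> ereal M \<longleftrightarrow>
    (\<forall>\<phi>. test_field \<phi> \<longrightarrow> (\<integral>x. u x * divergence \<phi> x \<partial>lborel) \<le> M)"
proof -
  have "integral\<^sup>L lebesgue (\<lambda>x. u x * divergence \<phi> x) = (\<integral>x. u x * divergence \<phi> x \<partial>lborel)" if "test_field \<phi>" for \<phi>
    using divergence_bounded_continuous[OF that] u by (metis integral_lebesgue_eq_lborel(1) borel_measurable_times)
  then show ?thesis by (auto simp: total_variation_def SUP_le_iff)
qed

lemma total_variation_nonneg: "total_variation u \<ge> 0"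
proof -
  have "test_field (\<lambda>x::'a. 0 :: 'a)"
    by (auto simp: test_field_def)
  then have "ereal (integral\<^sup>L lebesgue (\<lambda>x. u x * divergence (\<lambda>x. 0) x)) \<le> total_variation u"
    unfolding total_variation_def by (intro SUP_upper) auto
  then show ?thesis by (simp add: divergence_def zero_ereal_def)
qed

text \<open>\<open>TV_vec\<close> goes through \<open>real_of_ereal\<close>, which sends infinity to
  0; the conversion is faithful only because the variation is finite and nonnegative.\<close>

lemma total_variation_eq_ereal:
  assumes "u \<in> BV"
  shows "total_variation u = ereal (real_of_ereal (total_variation u))"
  using assms total_variation_nonneg[of u] unfolding BV_def
  by (cases "total_variation u") auto

lemma TV_vec_nonneg: "TV_vec u \<in> nonneg_orthant"
  by (auto simp: TV_vec_def nonneg_orthant_def intro!: real_of_ereal_pos total_variation_nonneg)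

lemma total_variation_cong_AE:
  fixes u v :: "'a::euclidean_space \<Rightarrow> real"
  assumes "u \<in> borel_measurable lebesgue" "v \<in> borel_measurable lebesgue" "AE x in lebesgue. u x = v x"
  shows "total_variation u = total_variation v"
  unfolding total_variation_def
proof (rule SUP_cong)
  fix \<phi> :: "'a \<Rightarrow> 'a" assume "\<phi> \<in> {\<phi>. test_field \<phi>}"
  then have "divergence \<phi> \<in> borel_measurable borel"
    using divergence_bounded_continuous by blast
  then have [measurable]: "divergence \<phi> \<in> borel_measurable lebesgue"
    by (simp add: measurable_completion)
  note [measurable] = assms(1,2)
  show "ereal (integral\<^sup>L lebesgue (\<lambda>x. u x * divergence \<phi> x)) = ereal (integral\<^sup>L lebesgue (\<lambda>x. v x * divergence \<phi> x))"
    unfolding ereal.inject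
    by (rule integral_cong_AE) (measurable, use assms(3) in \<open>auto elim!: eventually_mono\<close>)
qed simp

text \<open>Admissibility and total variation do not see null sets. Borel functions are wanted
  because their translates and iterated integrals stay measurable.\<close>

lemma one_N_function_borel_representative:
  fixes u :: "'n::finite \<Rightarrow> 'a::euclidean_space \<Rightarrow> real"
  assumes "one_N_function F u"
  obtains v where "one_N_function F v" "\<And>i. v i \<in> borel_measurable borel" "TV_vec v = TV_vec u"
proof -
  have u: "integrable lebesgue (u i)" for i
    using assms by (auto simp: one_N_function_def BV0_def BV_def)
  have "\<exists>v\<in>borel_measurable lborel. AE x in lborel. u i x = v x" for i
    by (rule completion_ex_borel_measurable_real) (use u in auto)
  then obtain v where v: "\<And>i. v i \<in> borel_measurable lborel" "\<And>i. AE x in lborel. u i x = v i x"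
    by metis
  have vb: "v i \<in> borel_measurable borel" for i using v(1)[of i] by simp
  have vl: "v i \<in> borel_measurable lebesgue" for i using v(1) by (rule measurable_completion)
  have ul: "u i \<in> borel_measurable lebesgue" for i using u by auto
  have ae: "AE x in lebesgue. u i x = v i x" for i using v(2) by (rule AE_completion)
  have tv: "total_variation (v i) = total_variation (u i)" for i
    by (rule total_variation_cong_AE[symmetric, OF ul vl ae])
  have int: "integrable lebesgue (v i)" for i
    using u[of i] integrable_cong_AE[OF ul vl ae, of i] by simp
  have abs: "integral\<^sup>L lebesgue (\<lambda>x. \<bar>v i x\<bar>) = integral\<^sup>L lebesgue (\<lambda>x. \<bar>u i x\<bar>)" for i
    by (rule integral_cong_AE) (use ul[of i] vl[of i] ae[of i] in \<open>auto elim!: eventually_mono\<close>)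
  have "one_N_function F v"
    unfolding one_N_function_def BV0_def BV_def
  proof (intro conjI allI impI CollectI)
    fix i
    have ui: "AE x in lebesgue. x \<notin> F \<longrightarrow> u i x = 0" "AE x in lebesgue. u i x \<ge> 0"
      "total_variation (u i) < \<infinity>" "integral\<^sup>L lebesgue (\<lambda>x. \<bar>u i x\<bar>) = 1"
      using assms by (auto simp: one_N_function_def BV0_def BV_def)
    show "integrable lebesgue (v i)" by (rule int)
    show "total_variation (v i) < \<infinity>" using ui(3) tv by simp
    show "AE x in lebesgue. x \<notin> F \<longrightarrow> v i x = 0"
      using ui(1) ae[of i] by eventually_elim auto
    show "AE x in lebesgue. v i x \<ge> 0"
      using ui(2) ae[of i] by eventually_elim auto
    show "integral\<^sup>L lebesgue (\<lambda>x. \<bar>v i x\<bar>) = 1" using ui(4) abs by simp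
    fix j assume "i \<noteq> j"
    then have "AE x in lebesgue. u i x * u j x = 0" using assms by (auto simp: one_N_function_def)
    then show "AE x in lebesgue. v i x * v j x = 0"
      using ae[of i] ae[of j] by eventually_elim auto
  qed
  moreover have "TV_vec v = TV_vec u" by (simp add: TV_vec_def tv)
  ultimately show ?thesis using vb that by blast
qed



section \<open>Competitors: normalized cones of finite variation\<close>

section \<open>Existence of admissible functions\<close>

text \<open>Converse of the translation estimate, used to see that a cone has finite variation. Each
  component of \<open>\<phi>\<close> is bounded by 1 and contributes at most \<open>V\<close>,
  whence the dimension factor, harmless where only finiteness matters. Short shifts suffice because
  a limit in the step size is taken.\<close>

lemma pairing_divergence_le_of_translation_lipschitz:
  fixes u :: "'a::euclidean_space \<Rightarrow> real"
  assumes u: "integrable lborel u"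
    and transl: "\<And>h. norm h \<le> 1 \<Longrightarrow> (\<integral>x. \<bar>u (x + h) - u x\<bar> \<partial>lborel) \<le> norm h * V"
    and \<phi>: "test_field \<phi>"
  shows "(\<integral>x. u x * divergence \<phi> x \<partial>lborel) \<le> real DIM('a) * V"
proof -
  have C: "C1c \<phi>" and \<phi>1: "\<And>x. norm (\<phi> x) \<le> 1" using \<phi> by (auto simp: test_field_iff_C1c)
  have [measurable]: "u \<in> borel_measurable borel" using u by (simp add: integrable_iff_bounded)
  have comp: "integrable lborel (\<lambda>x. u x * (frechet_derivative \<phi> (at x) b \<bullet> b))"
    "(\<integral>x. u x * (frechet_derivative \<phi> (at x) b \<bullet> b) \<partial>lborel) \<le> V" if b: "b \<in> Basis" for b
  proof -
    define \<psi> where "\<psi> = (\<lambda>x. \<phi> x \<bullet> b)"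
    note shift = C1c_compose_shift_linear[OF C bounded_linear_inner_left[of b], of 0]
    have \<psi>: "C1c \<psi>" using shift(1) by (simp add: \<psi>_def)
    have D: "frechet_derivative \<psi> (at x) b = frechet_derivative \<phi> (at x) b \<bullet> b" for x
      using shift(2)[of x] by (simp add: \<psi>_def)
    have \<psi>1: "\<bar>\<psi> x\<bar> \<le> 1" for x
      using Basis_le_norm[OF b, of "\<phi> x"] \<phi>1[of x] by (simp add: \<psi>_def)
    have [measurable]: "\<psi> \<in> borel_measurable borel"
      using C1c_continuous[OF \<psi>] by (simp add: borel_measurable_continuous_onI)
    obtain L where L: "\<And>x v. norm (frechet_derivative \<psi> (at x) v) \<le> L * norm v"
      using C1c_frechet_derivative_bound[OF \<psi>] by metis
    have "integrable lborel (\<lambda>x. u x * frechet_derivative \<psi> (at x) b)"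
      by (rule integrable_mult_bounded[OF u, where B = "L * norm b"])
        (use L C1c_frechet_derivative_continuous[OF \<psi>] in \<open>auto simp: borel_measurable_continuous_onI\<close>)
    then show "integrable lborel (\<lambda>x. u x * (frechet_derivative \<phi> (at x) b \<bullet> b))" by (simp add: D)
    \<comment> \<open>The shift is moved from \<open>\<psi>\<close> to \<open>u\<close>, where the
      translation hypothesis applies.\<close>
    have quot: "(\<integral>x. u x * ((\<psi> (x + h *\<^sub>R b) - \<psi> x) / h) \<partial>lborel) \<le> V" if h: "0 < h" "h \<le> 1" for h
    proof -
      have ish: "integrable lborel (\<lambda>x. u (x + - (h *\<^sub>R b)))"
        using u by (simp only: integral_lborel_translate(2)[of u "- (h *\<^sub>R b)"] \<open>u \<in> borel_measurable borel\<close>)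
      have i: "integrable lborel (\<lambda>x. u x * \<psi> (x + h *\<^sub>R b))" "integrable lborel (\<lambda>x. u x * \<psi> x)"
        "integrable lborel (\<lambda>x. u (x + - (h *\<^sub>R b)) * \<psi> x)"
        by (rule integrable_mult_bounded[where B = 1]; use u ish \<psi>1 in simp)+
      have "(\<integral>x. u x * ((\<psi> (x + h *\<^sub>R b) - \<psi> x) / h) \<partial>lborel)
          = ((\<integral>x. u x * \<psi> (x + h *\<^sub>R b) \<partial>lborel) - (\<integral>x. u x * \<psi> x \<partial>lborel)) / h"
        using i by (simp add: right_diff_distrib diff_divide_distrib)
      also have "(\<integral>x. u x * \<psi> (x + h *\<^sub>R b) \<partial>lborel) = (\<integral>x. u ((x + h *\<^sub>R b) + - (h *\<^sub>R b)) * \<psi> (x + h *\<^sub>R b) \<partial>lborel)"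
        by simp
      also have "\<dots> = (\<integral>x. u (x + - (h *\<^sub>R b)) * \<psi> x \<partial>lborel)"
        by (rule integral_lborel_translate(1)[of "\<lambda>x. u (x + - (h *\<^sub>R b)) * \<psi> x"]) measurable
      also have "\<dots> - (\<integral>x. u x * \<psi> x \<partial>lborel) = (\<integral>x. (u (x + - (h *\<^sub>R b)) - u x) * \<psi> x \<partial>lborel)"
        using i by (simp add: left_diff_distrib)
      also have "\<dots> \<le> (\<integral>x. \<bar>u (x + - (h *\<^sub>R b)) - u x\<bar> \<partial>lborel)"
      proof (rule integral_mono)
        show "integrable lborel (\<lambda>x. (u (x + - (h *\<^sub>R b)) - u x) * \<psi> x)"
          using i by (simp add: left_diff_distrib)
        show "integrable lborel (\<lambda>x. \<bar>u (x + - (h *\<^sub>R b)) - u x\<bar>)"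
          using u ish by simp
        show "(u (x + - (h *\<^sub>R b)) - u x) * \<psi> x \<le> \<bar>u (x + - (h *\<^sub>R b)) - u x\<bar>" for x
        proof -
          have "\<bar>(u (x + - (h *\<^sub>R b)) - u x) * \<psi> x\<bar> \<le> \<bar>u (x + - (h *\<^sub>R b)) - u x\<bar>"
            unfolding abs_mult using \<psi>1[of x] by (intro mult_left_le) auto
          then show ?thesis by linarith
        qed
      qed
      also have "\<dots> \<le> h * V"
        using transl[of "- (h *\<^sub>R b)"] h b by simp
      finally show ?thesis using h by (simp add: divide_right_mono divide_le_eq mult.commute)
    qed
    \<comment> \<open>A one-sided limit suffices; the bound is available for positive steps up to
      1.\<close>
    have "((\<lambda>h. \<integral>x. u x * ((\<psi> (x + h *\<^sub>R b) - \<psi> x) / h) \<partial>lborel) \<longlongrightarrow>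
        (\<integral>x. u x * frechet_derivative \<psi> (at x) b \<partial>lborel)) (at_right 0)"
      using C1c_difference_quotient_integral[OF u \<psi>] by (rule filterlim_mono) (auto intro: at_le)
    then have "(\<integral>x. u x * frechet_derivative \<psi> (at x) b \<partial>lborel) \<le> V"
    proof (rule tendsto_upperbound)
      have "eventually (\<lambda>h::real. h < 1) (at_right 0)"
        by (rule eventually_at_rightI[of 0 1]) auto
      with eventually_at_right_less[of "0::real"]
      show "eventually (\<lambda>h. (\<integral>x. u x * ((\<psi> (x + h *\<^sub>R b) - \<psi> x) / h) \<partial>lborel) \<le> V) (at_right 0)"
        by eventually_elim (rule quot, auto)
    qed simp
    then show "(\<integral>x. u x * (frechet_derivative \<phi> (at x) b \<bullet> b) \<partial>lborel) \<le> V" by (simp add: D)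
  qed
  have "(\<integral>x. u x * divergence \<phi> x \<partial>lborel) = (\<Sum>b\<in>Basis. \<integral>x. u x * (frechet_derivative \<phi> (at x) b \<bullet> b) \<partial>lborel)"
    unfolding divergence_def sum_distrib_left by (rule Bochner_Integration.integral_sum) (use comp in auto)
  also have "\<dots> \<le> (\<Sum>b\<in>(Basis::'a set). V)" by (rule sum_mono) (use comp in auto)
  finally show ?thesis by simp
qed

text \<open>The cone is 1-Lipschitz with bounded support, so its translation differences are
  explicitly controlled.\<close>

lemma normalized_BV_function_on_ball:
  fixes c :: "'a::euclidean_space"
  assumes r: "r > 0"
  obtains f where "f \<in> borel_measurable borel" "\<And>x. f x \<ge> 0" "integrable lborel f"
    "(\<integral>x. f x \<partial>lborel) = 1" "\<And>x. x \<notin> ball c r \<Longrightarrow> f x = 0" "total_variation f < \<infinity>"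
proof -
  define g where "g = (\<lambda>x. max 0 (r - dist x c))"
  have [measurable]: "g \<in> borel_measurable borel" unfolding g_def by measurable
  have fin: "emeasure lborel (cball c R) < \<infinity>" for R
    by (rule emeasure_bounded_finite) simp
  have ind: "integrable lborel (\<lambda>x. indicator (cball c R) x * K)" for R and K :: real
    using fin by (intro integrable_mult_left integrable_real_indicator) auto
  have g: "integrable lborel g"
    by (rule Bochner_Integration.integrable_bound[OF ind[of r r]])
      (measurable, use r in \<open>auto simp: g_def indicator_def dist_commute intro!: AE_I2\<close>)
  have pos: "(\<integral>x. g x \<partial>lborel) > 0"
  proof -
    \<comment> \<open>On the ball of half the radius the cone is at least \<open>r / 2\<close>, so
      its mass is positive.\<close>
    have B: "measure lborel (ball c (r/2)) > 0" using r content_ball_pos[of "r/2" c] by simp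
    have "0 < (\<integral>x. indicator (ball c (r/2)) x * (r/2) \<partial>lborel)" using r B by simp
    also have "\<dots> \<le> (\<integral>x. g x \<partial>lborel)"
    proof (rule integral_mono)
      show "integrable lborel (\<lambda>x. indicator (ball c (r/2)) x * (r/2))"
        using emeasure_lborel_ball_finite[of c "r/2"] by (intro integrable_mult_left integrable_real_indicator) auto
    qed (use g in \<open>auto simp: g_def indicator_def dist_commute max_def\<close>)
    finally show ?thesis .
  qed
  define m where "m = (\<integral>x. g x \<partial>lborel)"
  define f where "f = (\<lambda>x. g x / m)"
  \<comment> \<open>For shifts of length at most 1 the difference of \<open>g\<close> vanishes
    outside the ball of radius \<open>r + 1\<close> and is at most \<open>norm h\<close> inside;
    dividing by the mass \<open>m\<close> gives this constant.\<close>
  define V where "V = measure lborel (cball c (r + 1)) / m"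
  have f: "integrable lborel f" "f \<in> borel_measurable borel" unfolding f_def using g by auto
  have "(\<integral>x. \<bar>f (x + h) - f x\<bar> \<partial>lborel) \<le> norm h * V" if h: "norm h \<le> 1" for h
  proof -
    have ish: "integrable lborel (\<lambda>x. g (x + h))" using g by (simp add: integral_lborel_translate)
    have "(\<integral>x. \<bar>f (x + h) - f x\<bar> \<partial>lborel) = (\<integral>x. \<bar>g (x + h) - g x\<bar> \<partial>lborel) / m"
      using pos by (simp add: f_def m_def diff_divide_distrib[symmetric])
    also have "(\<integral>x. \<bar>g (x + h) - g x\<bar> \<partial>lborel) \<le> (\<integral>x. indicator (cball c (r + 1)) x * norm h \<partial>lborel)"
    proof (rule integral_mono[OF _ ind])
      show "integrable lborel (\<lambda>x. \<bar>g (x + h) - g x\<bar>)" using g ish by auto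
      fix x
      have d: "\<bar>dist (x + h) c - dist x c\<bar> \<le> norm h"
        using norm_triangle_ineq3[of "x + h - c" "x - c"] by (simp add: dist_norm)
      show "\<bar>g (x + h) - g x\<bar> \<le> indicator (cball c (r + 1)) x * norm h"
      proof (cases "x \<in> cball c (r + 1)")
        case True
        then show ?thesis using d by (simp add: g_def)
      next
        case False
        then have "dist x c > r + 1" by (simp add: dist_commute)
        then show ?thesis using d h False by (simp add: g_def)
      qed
    qed
    also have "\<dots> = measure lborel (cball c (r + 1)) * norm h" by simp
    finally show ?thesis using pos by (simp add: V_def m_def divide_right_mono mult.commute)
  qed
  from pairing_divergence_le_of_translation_lipschitz[OF f(1) this]
  have "total_variation f \<le> ereal (real DIM('a) * V)"
    using total_variation_le_iff[OF f(2)] by blast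
  then have tv: "total_variation f < \<infinity>" by (auto intro: le_less_trans)
  show ?thesis
  proof (rule that[OF f(2) _ f(1) _ _ tv])
    show "f x \<ge> 0" for x using pos by (simp add: f_def g_def m_def)
    show "(\<integral>x. f x \<partial>lborel) = 1" using pos by (simp add: f_def m_def)
    show "x \<notin> ball c r \<Longrightarrow> f x = 0" for x by (simp add: f_def g_def dist_commute)
  qed
qed

text \<open>A nonempty open set is infinite and so has room for one centre per component; disjoint
  balls make the products vanish everywhere.\<close>

lemma one_N_function_exists:
  fixes \<Omega> :: "'a::euclidean_space set"
  assumes "open \<Omega>" "\<Omega> \<noteq> {}"
  obtains u :: "'n::finite \<Rightarrow> 'a \<Rightarrow> real" where "one_N_function \<Omega> u"
proof -
  have "infinite \<Omega>" using assms finite_imp_not_open by blast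
  then obtain P where P: "P \<subseteq> \<Omega>" "finite P" "card P = CARD('n)"
    using infinite_arbitrarily_large by blast
  then obtain p :: "'n \<Rightarrow> 'a" where p: "bij_betw p UNIV P"
    using finite_same_card_bij[of "UNIV::'n set" P] by auto
  have inj: "p i \<noteq> p j" if "i \<noteq> j" for i j
    using p that by (auto simp: bij_betw_def inj_on_def)
  have in\<Omega>: "p i \<in> \<Omega>" for i using p P(1) by (auto simp: bij_betw_def)
  have 1: "\<forall>\<^sub>F r in at_right 0. ball (p i) r \<subseteq> \<Omega>" for i
  proof -
    obtain e where e: "e > 0" "ball (p i) e \<subseteq> \<Omega>"
      using assms(1) in\<Omega> open_contains_ball by blast
    show ?thesis
      by (rule eventually_at_rightI[of 0 e]) (use e in auto)
  qed
  have 2: "\<forall>\<^sub>F r in at_right 0. i \<noteq> j \<longrightarrow> ball (p i) r \<inter> ball (p j) r = {}" for i j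
  proof (cases "i = j")
    case False
    then have d: "dist (p i) (p j) > 0" using inj by simp
    show ?thesis
    proof (rule eventually_at_rightI[of 0 "dist (p i) (p j) / 2"])
      fix r assume "r \<in> {0<..<dist (p i) (p j) / 2}"
      then show "i \<noteq> j \<longrightarrow> ball (p i) r \<inter> ball (p j) r = {}"
        by (intro impI disjoint_ballI) auto
    qed (use d in simp)
  qed simp
  \<comment> \<open>Finitely many requirements, each valid for all small radii, hold together for
    some radius.\<close>
  have "\<forall>\<^sub>F r in at_right 0. (0 < r \<and> (\<forall>i. ball (p i) r \<subseteq> \<Omega>)) \<and> (\<forall>i j. i \<noteq> j \<longrightarrow> ball (p i) r \<inter> ball (p j) r = {})"
    using 1 2 by (intro eventually_conj eventually_all_finite eventually_at_right_less)
  from eventually_happens'[OF trivial_limit_at_right_real this]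
  obtain r where r: "r > 0" "\<forall>i. ball (p i) r \<subseteq> \<Omega>"
    and r_disj: "\<forall>i j. i \<noteq> j \<longrightarrow> ball (p i) r \<inter> ball (p j) r = {}"
    by (elim exE conjE)
  define Q where "Q = (\<lambda>i f. f \<in> borel_measurable borel \<and> (\<forall>x. f x \<ge> 0) \<and> integrable lborel f
      \<and> (\<integral>x. f x \<partial>lborel) = 1 \<and> (\<forall>x. x \<notin> ball (p i) r \<longrightarrow> f x = 0) \<and> total_variation f < \<infinity>)"
  have "\<forall>i. \<exists>f. Q i f"
  proof
    fix i
    show "\<exists>f. Q i f"
      unfolding Q_def by (rule normalized_BV_function_on_ball[OF r(1), of "p i"], rule exI, intro conjI allI impI)
  qed
  from choice[OF this] obtain u where Q: "\<And>i. Q i (u i)" by blast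
  have u: "\<And>i. u i \<in> borel_measurable borel" "\<And>i x. u i x \<ge> 0" "\<And>i. integrable lborel (u i)"
    "\<And>i. (\<integral>x. u i x \<partial>lborel) = 1" "\<And>i x. x \<notin> ball (p i) r \<Longrightarrow> u i x = 0" "\<And>i. total_variation (u i) < \<infinity>"
    using Q unfolding Q_def by blast+
  have "one_N_function \<Omega> u"
    unfolding one_N_function_def BV0_def BV_def
  proof (intro conjI allI impI CollectI AE_I2)
    fix i x
    show "x \<notin> \<Omega> \<Longrightarrow> u i x = 0" using u(5) r(2) by blast
    show "integral\<^sup>L lebesgue (\<lambda>x. \<bar>u i x\<bar>) = 1"
      using u(1,2,4) by (simp add: integral_lebesgue_eq_lborel)
    show "integrable lebesgue (u i)" using u(1,3) by (simp add: integral_lebesgue_eq_lborel)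
    fix j assume "i \<noteq> j"
    then have "x \<notin> ball (p i) r \<or> x \<notin> ball (p j) r" using r_disj by blast
    then show "u i x * u j x = 0" using u(5) by auto
  qed (use u in auto)
  then show ?thesis by (rule that)
qed

section \<open>Closedness of the constraints and lower semicontinuity under L1 convergence\<close>

section \<open>Passage to the limit\<close>

text \<open>Lets a pointwise constraint pass to the limit as the vanishing of a nonnegative defect
  bounded by L1 distances; no a.e. convergent subsequence has to be extracted.\<close>

lemma AE_eq_0_if_dominated_by_L1_null_sequence:
  fixes f :: "'a \<Rightarrow> real"
  assumes "integrable M f" "AE x in M. f x \<ge> 0" "\<And>n. integrable M (h n)" "\<And>n. AE x in M. f x \<le> h n x"
    and "(\<lambda>n. integral\<^sup>L M (h n)) \<longlonglongrightarrow> 0"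
  shows "AE x in M. f x = 0"
proof -
  have "integral\<^sup>L M f \<le> 0"
    by (rule LIMSEQ_le_const[OF assms(5)]) (use assms integral_mono_AE in blast)
  moreover have "integral\<^sup>L M f \<ge> 0" using assms(2) by (rule integral_nonneg_AE)
  ultimately have "integral\<^sup>L M f = 0" by simp
  then show ?thesis using integral_nonneg_eq_0_iff_AE[OF assms(1,2)] by simp
qed

text \<open>The divergence of a test field is bounded, so each pairing is L1-continuous. Convergent
  bounds \<open>v n\<close> replace a lower limit, because the variation vectors converge after a
  further extraction.\<close>

lemma total_variation_le_L1_limit:
  fixes u :: "nat \<Rightarrow> 'a::euclidean_space \<Rightarrow> real"
  assumes u: "\<And>n. integrable lborel (u n)" and g: "integrable lborel g"
    and lim: "(\<lambda>n. \<integral>x. \<bar>u n x - g x\<bar> \<partial>lborel) \<longlonglongrightarrow> 0"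
    and tv: "\<And>n. total_variation (u n) \<le> ereal (v n)" and v: "v \<longlonglongrightarrow> V"
  shows "total_variation g \<le> ereal V"
proof -
  have ub: "u n \<in> borel_measurable borel" for n using u by (simp add: integrable_iff_bounded)
  have gb: "g \<in> borel_measurable borel" using g by (simp add: integrable_iff_bounded)
  have "(\<integral>x. g x * divergence \<phi> x \<partial>lborel) \<le> V" if \<phi>: "test_field \<phi>" for \<phi>
  proof -
    obtain L where L: "\<And>x. \<bar>divergence \<phi> x\<bar> \<le> L" and [measurable]: "divergence \<phi> \<in> borel_measurable borel"
      using divergence_bounded_continuous[OF \<phi>] by blast
    have i: "integrable lborel (\<lambda>x. w x * divergence \<phi> x)" if "integrable lborel w" for w
      by (rule integrable_mult_bounded[OF that _ L]) measurable
    have "(\<lambda>n. \<integral>x. (u n x - g x) * divergence \<phi> x \<partial>lborel) \<longlonglongrightarrow> 0"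
    proof (rule Lim_null_comparison)
      show "(\<lambda>n. (\<integral>x. \<bar>u n x - g x\<bar> \<partial>lborel) * L) \<longlonglongrightarrow> 0" by (rule tendsto_mult_left_zero[OF lim])
      show "\<forall>\<^sub>F n in sequentially. norm (\<integral>x. (u n x - g x) * divergence \<phi> x \<partial>lborel) \<le> (\<integral>x. \<bar>u n x - g x\<bar> \<partial>lborel) * L"
      proof (rule always_eventually, rule allI)
        fix n
        have "norm (\<integral>x. (u n x - g x) * divergence \<phi> x \<partial>lborel) \<le> (\<integral>x. norm ((u n x - g x) * divergence \<phi> x) \<partial>lborel)"
          by (rule integral_norm_bound)
        also have "\<dots> \<le> (\<integral>x. \<bar>u n x - g x\<bar> * L \<partial>lborel)"
          using u g L by (intro integral_mono integrable_norm i) (auto simp: abs_mult intro!: mult_left_mono)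
        finally show "norm (\<integral>x. (u n x - g x) * divergence \<phi> x \<partial>lborel) \<le> (\<integral>x. \<bar>u n x - g x\<bar> \<partial>lborel) * L"
          by simp
      qed
    qed
    moreover have "(\<integral>x. (u n x - g x) * divergence \<phi> x \<partial>lborel)
        = (\<integral>x. u n x * divergence \<phi> x \<partial>lborel) - (\<integral>x. g x * divergence \<phi> x \<partial>lborel)" for n
      using i[OF u] i[OF g] by (simp add: left_diff_distrib)
    ultimately have "(\<lambda>n. \<integral>x. u n x * divergence \<phi> x \<partial>lborel) \<longlonglongrightarrow> (\<integral>x. g x * divergence \<phi> x \<partial>lborel)"
      by (simp add: LIM_zero_iff)
    moreover have "(\<integral>x. u n x * divergence \<phi> x \<partial>lborel) \<le> v n" for n
      using tv[of n] total_variation_le_iff[OF ub] \<phi> by blast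
    ultimately show ?thesis using v by (intro LIMSEQ_le) auto
  qed
  then show ?thesis using total_variation_le_iff[OF gb] by blast
qed

text \<open>Finite variation is a hypothesis on \<open>g\<close>, since L1 convergence alone does
  not preserve it; lower semicontinuity supplies it.\<close>

lemma one_N_function_L1_limit:
  fixes u :: "nat \<Rightarrow> 'n::finite \<Rightarrow> 'a::euclidean_space \<Rightarrow> real"
  assumes u: "\<And>n. one_N_function F (u n)" "\<And>n i. u n i \<in> borel_measurable borel"
    and F: "F \<in> sets borel"
    and g: "\<And>i. integrable lborel (g i)"
    and lim: "\<And>i. (\<lambda>n. \<integral>x. \<bar>u n i x - g i x\<bar> \<partial>lborel) \<longlonglongrightarrow> 0"
    and tv: "\<And>i. total_variation (g i) < \<infinity>"
  shows "one_N_function F g"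
proof -
  have ui: "integrable lborel (u n i)" for n i
    using u by (auto simp: one_N_function_def BV0_def BV_def integral_lebesgue_eq_lborel)
  have nonneg: "AE x in lborel. u n i x \<ge> 0" for n i
    using u(1) by (auto simp: one_N_function_def AE_completion_iff)
  have off: "AE x in lborel. x \<notin> F \<longrightarrow> u n i x = 0" for n i
    using u(1) by (auto simp: one_N_function_def BV0_def AE_completion_iff)
  have prod: "AE x in lborel. u n i x * u n j x = 0" if "i \<noteq> j" for n i j
    using u(1) that by (auto simp: one_N_function_def AE_completion_iff)
  have norm: "(\<integral>x. \<bar>u n i x\<bar> \<partial>lborel) = 1" for n i
    using u by (auto simp: one_N_function_def integral_lebesgue_eq_lborel)
  have gb: "g i \<in> borel_measurable borel" for i using g by (simp add: integrable_iff_bounded)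
  have di: "integrable lborel (\<lambda>x. \<bar>u n i x - g i x\<bar>)" for n i using ui g by auto
  have g_nonneg: "AE x in lborel. g i x \<ge> 0" for i
  proof -
    \<comment> \<open>The defect is the negative part of \<open>g i\<close>, at most the distance to
      a nonnegative function.\<close>
    have "AE x in lborel. max 0 (- g i x) = 0"
    proof (rule AE_eq_0_if_dominated_by_L1_null_sequence[OF _ _ di _ lim])
      show "AE x in lborel. max 0 (- g i x) \<le> \<bar>u n i x - g i x\<bar>" for n
        using nonneg[of n i] by eventually_elim auto
    qed (use g in auto)
    then show ?thesis by eventually_elim (auto simp: max_def split: if_splits)
  qed
  have g_off: "AE x in lborel. x \<notin> F \<longrightarrow> g i x = 0" for i
  proof -
    have "AE x in lborel. indicator (- F) x * \<bar>g i x\<bar> = 0"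
    proof (rule AE_eq_0_if_dominated_by_L1_null_sequence[OF _ _ di _ lim])
      show "AE x in lborel. indicator (- F) x * \<bar>g i x\<bar> \<le> \<bar>u n i x - g i x\<bar>" for n
        using off[of n i] by eventually_elim (auto simp: indicator_def)
      show "integrable lborel (\<lambda>x. indicator (- F) x * \<bar>g i x\<bar>)"
        using g F by (intro integrable_indicator_mult) auto
    qed auto
    then show ?thesis by eventually_elim (auto simp: indicator_def split: if_splits)
  qed
  have g_prod: "AE x in lborel. g i x * g j x = 0" if "i \<noteq> j" for i j
  proof -
    \<comment> \<open>The minimum replaces the product, which need not be integrable. One of
      \<open>u n i x\<close> and \<open>u n j x\<close> is zero, so the minimum is bounded by the
      corresponding distance.\<close>
    have "AE x in lborel. min \<bar>g i x\<bar> \<bar>g j x\<bar> = 0"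
    proof (rule AE_eq_0_if_dominated_by_L1_null_sequence)
      show "AE x in lborel. min \<bar>g i x\<bar> \<bar>g j x\<bar> \<le> \<bar>u n i x - g i x\<bar> + \<bar>u n j x - g j x\<bar>" for n
        using prod[OF that, of n] by eventually_elim auto
      show "(\<lambda>n. \<integral>x. \<bar>u n i x - g i x\<bar> + \<bar>u n j x - g j x\<bar> \<partial>lborel) \<longlonglongrightarrow> 0"
        using tendsto_add[OF lim[of i] lim[of j]] di by simp
    qed (use g di in auto)
    then show ?thesis by eventually_elim (auto simp: min_def split: if_splits)
  qed
  have g_norm: "(\<integral>x. \<bar>g i x\<bar> \<partial>lborel) = 1" for i
  proof -
    have "(\<lambda>n. (\<integral>x. \<bar>g i x\<bar> \<partial>lborel) - 1) \<longlonglongrightarrow> 0"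
    proof (rule Lim_null_comparison[OF _ lim])
      show "\<forall>\<^sub>F n in sequentially. norm ((\<integral>x. \<bar>g i x\<bar> \<partial>lborel) - 1) \<le> (\<integral>x. \<bar>u n i x - g i x\<bar> \<partial>lborel)"
      proof (rule always_eventually, rule allI)
        fix n
        have "(\<integral>x. \<bar>g i x\<bar> \<partial>lborel) - 1 = (\<integral>x. \<bar>g i x\<bar> - \<bar>u n i x\<bar> \<partial>lborel)"
          using g ui norm by simp
        also have "norm \<dots> \<le> (\<integral>x. norm (\<bar>g i x\<bar> - \<bar>u n i x\<bar>) \<partial>lborel)" by (rule integral_norm_bound)
        also have "\<dots> \<le> (\<integral>x. \<bar>u n i x - g i x\<bar> \<partial>lborel)"
          using g ui by (intro integral_mono) auto
        finally show "norm ((\<integral>x. \<bar>g i x\<bar> \<partial>lborel) - 1) \<le> (\<integral>x. \<bar>u n i x - g i x\<bar> \<partial>lborel)" .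
      qed
    qed
    then show ?thesis by (simp add: LIMSEQ_const_iff)
  qed
  show ?thesis
    using g gb tv g_nonneg g_off g_prod g_norm
    by (simp add: one_N_function_def BV0_def BV_def AE_completion_iff integral_lebesgue_eq_lborel)
qed

section \<open>The direct method\<close>

theorem mainTheorem8:
  fixes \<Omega> :: "'a::euclidean_space set"
    and \<Phi> :: "real^'n::finite \<Rightarrow> real"
  assumes "\<Omega> \<noteq> {}" and "bounded \<Omega>" and "open \<Omega>"
    and "\<forall>v\<in>nonneg_orthant. \<Phi> v \<ge> 0"
    and "lsc_on nonneg_orthant \<Phi>"
    and "\<exists>\<delta>>0. \<forall>v\<in>nonneg_orthant. \<Phi> v \<ge> \<delta> * (\<Sum>i\<in>UNIV. v $ i)"
    and "\<forall>v\<in>nonneg_orthant. \<forall>w\<in>nonneg_orthant. (\<forall>i. v $ i \<le> w $ i) \<longrightarrow> \<Phi> v \<le> \<Phi> w"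
  shows "\<exists>u :: 'n \<Rightarrow> 'a \<Rightarrow> real. eigen_N_function \<Phi> \<Omega> u"
proof -
  define S where "S = {\<Phi> (TV_vec u) | u :: 'n \<Rightarrow> 'a \<Rightarrow> real. one_N_function \<Omega> u}"
  obtain \<delta> where \<delta>: "\<delta> > 0" "\<And>v. v \<in> nonneg_orthant \<Longrightarrow> \<Phi> v \<ge> \<delta> * (\<Sum>i\<in>UNIV. v $ i)"
    using assms(6) by blast
  \<comment> \<open>Without a competitor, the real-valued \<open>Inf\<close> would give no
    approximating sequence.\<close>
  have S_ne: "S \<noteq> {}" using one_N_function_exists[OF assms(3,1)] unfolding S_def by blast
  have S_bdd: "bdd_below S"
    using assms(4) TV_vec_nonneg by (intro bdd_belowI[of _ 0]) (auto simp: S_def)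
  have "\<exists>u :: 'n \<Rightarrow> 'a \<Rightarrow> real. one_N_function \<Omega> u \<and> (\<forall>i. u i \<in> borel_measurable borel)
      \<and> \<Phi> (TV_vec u) < Inf S + 1 / real (Suc k)" for k
  proof -
    obtain s where "s \<in> S" "s < Inf S + 1 / real (Suc k)"
      using cInf_lessD[OF S_ne, of "Inf S + 1 / real (Suc k)"] by auto
    then obtain w :: "'n \<Rightarrow> 'a \<Rightarrow> real" where w: "one_N_function \<Omega> w" "\<Phi> (TV_vec w) < Inf S + 1 / real (Suc k)"
      by (auto simp: S_def)
    then show ?thesis using one_N_function_borel_representative[OF w(1)] by metis
  qed
  then obtain u :: "nat \<Rightarrow> 'n \<Rightarrow> 'a \<Rightarrow> real" where
    u: "\<And>k. one_N_function \<Omega> (u k)" "\<And>k i. u k i \<in> borel_measurable borel"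
      "\<And>k. \<Phi> (TV_vec (u k)) < Inf S + 1 / real (Suc k)"
    by metis
  \<comment> \<open>All values of \<Phi> along the sequence are below \<open>Inf S + 1\<close>,
    since \<open>1 / real (Suc k)\<close> is at most 1; (\<Phi>.2) then bounds each variation after
    division by \<delta>.\<close>
  define M where "M = (Inf S + 1) / \<delta>"
  have tv: "total_variation (u k i) = ereal (TV_vec (u k) $ i)" for k i
    using u(1)[of k] total_variation_eq_ereal[of "u k i"] by (simp add: TV_vec_def one_N_function_def BV0_def)
  have tv0: "0 \<le> TV_vec (u k) $ i" for k i
    using TV_vec_nonneg[of "u k"] by (simp add: nonneg_orthant_def)
  have tvM: "TV_vec (u k) $ i \<le> M" for k i
  proof -
    have "TV_vec (u k) $ i \<le> (\<Sum>i\<in>UNIV. TV_vec (u k) $ i)"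
      using tv0 by (intro member_le_sum) auto
    then have "\<delta> * TV_vec (u k) $ i \<le> \<delta> * (\<Sum>i\<in>UNIV. TV_vec (u k) $ i)"
      using \<delta>(1) by simp
    also have "\<dots> \<le> \<Phi> (TV_vec (u k))" by (rule \<delta>(2)[OF TV_vec_nonneg])
    also have "\<dots> \<le> Inf S + 1 / real (Suc k)" using u(3)[of k] by simp
    also have "\<dots> \<le> Inf S + 1" by simp
    finally show ?thesis using \<delta>(1) by (simp add: M_def le_divide_eq mult.commute)
  qed
  have M: "M \<ge> 0" using tv0 tvM by (meson order_trans)
  have ui: "integrable lborel (u k i)" for k i
    using u(1,2) by (auto simp: one_N_function_def BV0_def BV_def integral_lebesgue_eq_lborel)
  obtain r g where r: "strict_mono (r :: nat \<Rightarrow> nat)" and g: "\<And>i. integrable lborel (g i)"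
    and lim: "\<And>i. (\<lambda>n. \<integral>x. \<bar>u (r n) i x - g i x\<bar> \<partial>lborel) \<longlonglongrightarrow> 0"
  proof (rule L1_compactness_of_translation_lipschitz[of \<Omega> u 1 M])
    show "(\<integral>x. \<bar>u k i x\<bar> \<partial>lborel) \<le> 1" for k i
      using u(1,2) by (auto simp: one_N_function_def integral_lebesgue_eq_lborel)
    show "(\<integral>x. \<bar>u k i (x + h) - u k i x\<bar> \<partial>lborel) \<le> norm h * M" for k i h
    proof (rule L1_translation_le_total_variation[OF ui])
      show "(\<integral>x. u k i x * divergence \<phi> x \<partial>lborel) \<le> M" if "test_field \<phi>" for \<phi>
        using total_variation_le_iff[OF u(2), of k i M] tv[of k i] tvM[of k i] that by auto
    qed
    show "AE x in lborel. x \<notin> \<Omega> \<longrightarrow> u k i x = 0" for k i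
      using u(1) by (auto simp: one_N_function_def BV0_def AE_completion_iff)
  qed (use assms ui M in auto)
  \<comment> \<open>A second extraction, in R^N, makes the variation vectors converge, as lower
    semicontinuity of \<Phi> is applied to them.\<close>
  have "bounded (range (\<lambda>n. TV_vec (u (r n))))"
  proof (rule boundedI)
    fix v assume "v \<in> range (\<lambda>n. TV_vec (u (r n)))"
    then obtain n where v: "v = TV_vec (u (r n))" by blast
    have "norm v \<le> (\<Sum>i\<in>UNIV. \<bar>v $ i\<bar>)" by (rule norm_le_l1_cart)
    also have "\<dots> \<le> (\<Sum>i\<in>(UNIV::'n set). M)" using tv0 tvM by (intro sum_mono) (simp add: v)
    finally show "norm v \<le> (\<Sum>i\<in>(UNIV::'n set). M)" .
  qed
  then obtain V s where s: "strict_mono (s :: nat \<Rightarrow> nat)" and "((\<lambda>n. TV_vec (u (r n))) \<circ> s) \<longlonglongrightarrow> V"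
    using bounded_imp_convergent_subsequence by blast
  then have V: "(\<lambda>n. TV_vec (u (r (s n)))) \<longlonglongrightarrow> V" by (simp add: comp_def)
  define w where "w = (\<lambda>n. u (r (s n)))"
  have Vi: "(\<lambda>n. TV_vec (w n) $ i) \<longlonglongrightarrow> V $ i" for i
    unfolding w_def by (rule tendsto_vec_nth[OF V])
  have limw: "(\<lambda>n. \<integral>x. \<bar>w n i x - g i x\<bar> \<partial>lborel) \<longlonglongrightarrow> 0" for i
    using LIMSEQ_subseq_LIMSEQ[OF lim s] by (simp add: w_def comp_def)
  have tvg: "total_variation (g i) \<le> ereal (V $ i)" for i
    by (rule total_variation_le_L1_limit[OF _ g limw _ Vi]) (use ui tv in \<open>auto simp: w_def\<close>)
  have tvg_fin: "total_variation (g i) < \<infinity>" for i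
    by (rule le_less_trans[OF tvg]) simp
  have one_g: "one_N_function \<Omega> g"
    by (rule one_N_function_L1_limit[OF _ _ _ g limw])
      (use u assms(3) tvg_fin in \<open>auto simp: w_def\<close>)
  have V_mem: "V \<in> nonneg_orthant"
    unfolding nonneg_orthant_def using LIMSEQ_le_const[OF Vi] tv0 by (auto simp: w_def)
  \<comment> \<open>Equality can fail here; monotonicity of \<Phi> absorbs the loss.\<close>
  have "TV_vec g $ i \<le> V $ i" for i
    using tvg[of i] total_variation_eq_ereal[of "g i"] one_g
    by (auto simp: TV_vec_def one_N_function_def BV0_def) (metis ereal_less_eq(3))
  then have "\<Phi> (TV_vec g) \<le> \<Phi> V" using assms(7) TV_vec_nonneg V_mem by blast
  also have "\<Phi> V \<le> Inf S"
  proof (rule ccontr)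
    assume "\<not> \<Phi> V \<le> Inf S"
    then obtain t where t: "Inf S < t" "t < \<Phi> V" using dense not_le by blast
    then have "\<forall>\<^sub>F y in at V within nonneg_orthant. t < \<Phi> y"
      using assms(5) V_mem by (auto simp: lsc_on_def)
    \<comment> \<open>The filter at \<open>V\<close> omits \<open>V\<close> itself, so that case is
      split off; there \<open>t < \<Phi> V\<close> holds by the choice of \<open>t\<close>.\<close>
    then have "\<forall>\<^sub>F y in nhds V. y \<noteq> V \<longrightarrow> y \<in> nonneg_orthant \<longrightarrow> t < \<Phi> y"
      by (simp add: eventually_at_filter)
    then have "\<forall>\<^sub>F n in sequentially. TV_vec (w n) \<noteq> V \<longrightarrow> TV_vec (w n) \<in> nonneg_orthant \<longrightarrow> t < \<Phi> (TV_vec (w n))"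
      using V unfolding w_def by (auto simp: filterlim_iff)
    moreover have "\<forall>\<^sub>F n in sequentially. 1 / real (Suc n) < t - Inf S"
      using LIMSEQ_inverse_real_of_nat t(1) by (intro order_tendstoD(2)[of _ 0]) (simp_all add: inverse_eq_divide)
    ultimately have "\<forall>\<^sub>F n in sequentially. False"
    proof eventually_elim
      fix n
      assume *: "TV_vec (w n) \<noteq> V \<longrightarrow> TV_vec (w n) \<in> nonneg_orthant \<longrightarrow> t < \<Phi> (TV_vec (w n))"
        and n: "1 / real (Suc n) < t - Inf S"
      have "t < \<Phi> (TV_vec (w n))" using * t(2) TV_vec_nonneg by (cases "TV_vec (w n) = V") auto
      also have "\<dots> < Inf S + 1 / real (Suc (r (s n)))" unfolding w_def by (rule u(3))
      also have "\<dots> \<le> Inf S + 1 / real (Suc n)"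
      proof -
        have "n \<le> r (s n)"
          using seq_suble[OF s, of n] seq_suble[OF r, of "s n"] by linarith
        then show ?thesis by (simp add: frac_le)
      qed
      finally show False using n by simp
    qed
    then show False by simp
  qed
  finally have "\<Phi> (TV_vec g) \<le> Inf S" .
  moreover have "Inf S \<le> \<Phi> (TV_vec g)" using one_g S_bdd by (intro cInf_lower) (auto simp: S_def)
  ultimately have "\<Phi> (TV_vec g) = Lambda_1_1 \<Phi> \<Omega>" by (simp add: Lambda_1_1_def S_def)
  with one_g show ?thesis unfolding eigen_N_function_def by blast
qed

end
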